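(* Let $(X_0,\tau_0)$ be a complete Hausdorff locally convex space whose topology is given by a system $(p_{\gamma,0})_{\gamma\in\Gamma}$ of seminorms, and let $T_0=(T_0(t))_{t\geqslant 0}$ be a strongly continuous and exponentially equicontinuous semigroup on $X_0$ whose generator $A_0\colon D(A_0)\to X_0$ is bijective with continuous inverse $A_0^{-1}\colon X_0\to X_0$. Let $(X_n,\tau_n)$, $T_n$, $A_n$ ($n\geqslant 0$) be the spaces, semigroups and generators of the associated Sobolev tower with non-negative index, and let $(X_\infty,\tau_\infty)=\operatorname{proj}_{n}(X_n,\tau_n)$ be the associated universal interpolation space, with $T_\infty$ and $A_\infty$ the restrictions of $T_0$ and $A_0$ to $X_\infty$. Then $X_\infty=\operatorname{proj}_nX_n$ is a reduced projective limit and $X_\infty$ is complete. $T_\infty$ is a strongly continuous and exponentially equicontinuous semigroup on $X_\infty$ with generator $(A_\infty,X_\infty)$. In particular, $A_\infty\colon X_\infty\to X_\infty$ is an isomorphism (linear homeomorphism); its inverse is given as the restriction to $X_\infty$ of the inverse of $A_n$, for any $n$.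
   Context: A strongly continuous and exponentially equicontinuous semigroup on a locally convex space $Y$ is a map $T\colon[0,\infty)\to L(Y)$ (continuous linear operators on $Y$) such that $T(t+s)=T(t)T(s)$ for $s,t\geqslant 0$, $T(0)=I$, $t\mapsto T(t)x$ is continuous for every $x\in Y$, and there is $\omega\in\mathbb{R}$ such that $\{e^{\omega t}T(t) : t\geqslant 0\}\subseteq L(Y)$ is equicontinuous. Its generator $(A,D(A))$ is $Ax=\lim_{t\searrow 0}\frac{T(t)x-x}{t}$ with $D(A)$ the set of all $x\in Y$ for which this limit exists. The part of the Sobolev tower with non-negative indices is defined recursively: for $n\geqslant 1$, $X_n=D(A_{n-1})$ with topology $\tau_n$ given by the seminorms $p_{\gamma,n}(x)=p_{\gamma,n-1}(A_{n-1}x)$, $x\in X_n$, $\gamma\in\Gamma$; $T_n(t)=T_{n-1}(t)|_{X_n}\colon X_n\to X_n$ for $t\geqslant 0$; and $(A_n,D(A_n))$ is the generator of $T_n=(T_n(t))_{t\geqslant 0}$. Each $(X_n,\tau_n)$ is complete, each $T_n$ is a strongly continuous exponentially equicontinuous semigroup on $X_n$, the inclusions $X_n\hookrightarrow X_{n-1}$ are continuous, and $A_n\colon X_{n+1}\to X_n$ is a linear homeomorphism that is the restriction of $A_{n-1}$. (The paper's tower also has spaces $X_n\supseteq X_0$ for $n<0$; they do not affect the projective limit.) The universal interpolation space is $X_\infty=\bigcap_{n\geqslant 0}X_n$ with the coarsest locally convex topology $\tau_\infty$ making all inclusions $X_\infty\to X_n$ continuous. Define $T_\infty(t)x=T_0(t)x$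 ($t\geqslant 0$) and $A_\infty x=A_0x$ for $x\in X_\infty$. The projective limit is called reduced if $X_\infty$ is dense in $(X_n,\tau_n)$ for every $n\geqslant 0$. *)

theory Defs
  imports "HOL-Analysis.Analysis"
begin

text \<open>
  The scalar field is any type of class \<open>real_normed_field\<close>, which covers the real and the
  complex numbers. A locally convex space is given by its topology \<open>\<tau>\<close>, whose carrier
  \<open>topspace \<tau>\<close> is a linear subspace of an ambient vector space. Operators are total functions
  on the ambient space; their values outside the carrier (or domain) are irrelevant, so the
  restriction of an operator to a smaller carrier is the same function.
\<close>

definition seminorm_on ::
  "('k::real_normed_field \<Rightarrow> 'a::ab_group_add \<Rightarrow> 'a) \<Rightarrow> 'a set \<Rightarrow> ('a \<Rightarrow> real) \<Rightarrow> bool" where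
  "seminorm_on smul S p \<longleftrightarrow>
     (\<forall>x\<in>S. \<forall>y\<in>S. p (x + y) \<le> p x + p y) \<and>
     (\<forall>c. \<forall>x\<in>S. p (smul c x) = norm c * p x)"

definition seminorm_topology :: "'a::ab_group_add set \<Rightarrow> ('a \<Rightarrow> real) set \<Rightarrow> 'a topology" where
  "seminorm_topology S P = topology (\<lambda>U. U \<subseteq> S \<and>
     (\<forall>x\<in>U. \<exists>F e. finite F \<and> F \<subseteq> P \<and> 0 < e \<and> {y\<in>S. \<forall>p\<in>F. p (y - x) < e} \<subseteq> U))"

lemma openin_seminorm_topology:
  "openin (seminorm_topology S P) U \<longleftrightarrow> U \<subseteq> S \<and>
     (\<forall>x\<in>U. \<exists>F e. finite F \<and> F \<subseteq> P \<and> 0 < e \<and> {y\<in>S. \<forall>p\<in>F. p (y - x) < e} \<subseteq> U)"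
proof -
  let ?N = "\<lambda>U x. \<exists>F e. finite F \<and> F \<subseteq> P \<and> (0::real) < e \<and> {y\<in>S. \<forall>p\<in>F. p (y - x) < e} \<subseteq> U"
  have mono: "?N V x" if "?N U x" "U \<subseteq> V" for U V x
    using that by (meson subset_trans)
  have inter: "?N (U \<inter> V) x" if U: "?N U x" and V: "?N V x" for U V x
  proof -
    obtain F e where F: "finite F" "F \<subseteq> P" "0 < e" "{y\<in>S. \<forall>p\<in>F. p (y - x) < e} \<subseteq> U"
      using U by blast
    obtain G d where G: "finite G" "G \<subseteq> P" "0 < d" "{y\<in>S. \<forall>p\<in>G. p (y - x) < d} \<subseteq> V"
      using V by blast
    have "{y\<in>S. \<forall>p\<in>F \<union> G. p (y - x) < min e d} \<subseteq> U \<inter> V"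
      using F(4) G(4) by fastforce
    moreover have "finite (F \<union> G)" "F \<union> G \<subseteq> P" "0 < min e d"
      using F G by auto
    ultimately show ?thesis by blast
  qed
  have "istopology (\<lambda>U. U \<subseteq> S \<and> (\<forall>x\<in>U. ?N U x))"
    unfolding istopology_def
  proof (intro conjI allI impI)
    fix U V
    assume UV: "U \<subseteq> S \<and> (\<forall>x\<in>U. ?N U x)" "V \<subseteq> S \<and> (\<forall>x\<in>V. ?N V x)"
    then show "U \<inter> V \<subseteq> S" by blast
    show "\<forall>x\<in>U \<inter> V. ?N (U \<inter> V) x"
      using UV inter by simp
  next
    fix K
    assume K: "\<forall>U\<in>K. U \<subseteq> S \<and> (\<forall>x\<in>U. ?N U x)"
    then show "\<Union>K \<subseteq> S" by blast
    show "\<forall>x\<in>\<Union>K. ?N (\<Union>K) x"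
    proof
      fix x assume "x \<in> \<Union>K"
      then obtain U where U: "U \<in> K" "x \<in> U" by blast
      show "?N (\<Union>K) x"
      proof (rule mono)
        show "?N U x" using K U by simp
        show "U \<subseteq> \<Union>K" using U(1) by blast
      qed
    qed
  qed
  then show ?thesis
    unfolding seminorm_topology_def by (simp add: topology_inverse')
qed

lemma topspace_seminorm_topology [simp]: "topspace (seminorm_topology S P) = S"
proof
  show "topspace (seminorm_topology S P) \<subseteq> S"
    using openin_seminorm_topology[of S P] openin_topspace by blast
  have "openin (seminorm_topology S P) S"
    unfolding openin_seminorm_topology
    by (intro conjI ballI subset_refl exI[of _ "{}"] exI[of _ "1::real"]) auto
  then show "S \<subseteq> topspace (seminorm_topology S P)"
    by (rule openin_subset)
qed

definition locally_convex ::
  "('k::real_normed_field \<Rightarrow> 'a::ab_group_add \<Rightarrow> 'a) \<Rightarrow> 'a topology \<Rightarrow> bool" where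
  "locally_convex smul \<tau> \<longleftrightarrow> module.subspace smul (topspace \<tau>) \<and>
     (\<exists>P. (\<forall>p\<in>P. seminorm_on smul (topspace \<tau>) p) \<and> \<tau> = seminorm_topology (topspace \<tau>) P)"

definition cauchy_filter_in :: "'a::ab_group_add topology \<Rightarrow> 'a filter \<Rightarrow> bool" where
  "cauchy_filter_in \<tau> F \<longleftrightarrow> F \<noteq> bot \<and> (\<forall>\<^sub>F x in F. x \<in> topspace \<tau>) \<and>
     (\<forall>V. openin \<tau> V \<and> 0 \<in> V \<longrightarrow> (\<forall>\<^sub>F (x, y) in F \<times>\<^sub>F F. x - y \<in> V))"

definition complete_locally_convex ::
  "('k::real_normed_field \<Rightarrow> 'a::ab_group_add \<Rightarrow> 'a) \<Rightarrow> 'a topology \<Rightarrow> bool" where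
  "complete_locally_convex smul \<tau> \<longleftrightarrow> locally_convex smul \<tau> \<and>
     (\<forall>F. cauchy_filter_in \<tau> F \<longrightarrow> (\<exists>x. limitin \<tau> (\<lambda>y. y) x F))"

definition linear_on_carrier ::
  "('k::real_normed_field \<Rightarrow> 'a::ab_group_add \<Rightarrow> 'a) \<Rightarrow> 'a set \<Rightarrow> ('a \<Rightarrow> 'a) \<Rightarrow> bool" where
  "linear_on_carrier smul S f \<longleftrightarrow>
     (\<forall>x\<in>S. \<forall>y\<in>S. f (x + y) = f x + f y) \<and>
     (\<forall>c. \<forall>x\<in>S. f (smul c x) = smul c (f x))"

definition continuous_operators ::
  "('k::real_normed_field \<Rightarrow> 'a::ab_group_add \<Rightarrow> 'a) \<Rightarrow> 'a topology \<Rightarrow> ('a \<Rightarrow> 'a) set" where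
  "continuous_operators smul \<tau> =
     {f. linear_on_carrier smul (topspace \<tau>) f \<and> continuous_map \<tau> \<tau> f}"

text \<open>For sets of linear operators, equicontinuity at the origin is equicontinuity.\<close>

definition equicontinuous_operators ::
  "('k::real_normed_field \<Rightarrow> 'a::ab_group_add \<Rightarrow> 'a) \<Rightarrow> 'a topology \<Rightarrow> ('a \<Rightarrow> 'a) set \<Rightarrow> bool" where
  "equicontinuous_operators smul \<tau> H \<longleftrightarrow> H \<subseteq> continuous_operators smul \<tau> \<and>
     (\<forall>V. openin \<tau> V \<and> 0 \<in> V \<longrightarrow> (\<exists>U. openin \<tau> U \<and> 0 \<in> U \<and> (\<forall>f\<in>H. f ` U \<subseteq> V)))"

definition sc_exp_equicontinuous_semigroup ::
  "('k::real_normed_field \<Rightarrow> 'a::ab_group_add \<Rightarrow> 'a) \<Rightarrow> 'a topology \<Rightarrow> (real \<Rightarrow> 'a \<Rightarrow> 'a) \<Rightarrow> bool" where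
  "sc_exp_equicontinuous_semigroup smul \<tau> T \<longleftrightarrow>
     (\<forall>t\<ge>0. T t \<in> continuous_operators smul \<tau>) \<and>
     (\<forall>t\<ge>0. \<forall>s\<ge>0. \<forall>x\<in>topspace \<tau>. T (t + s) x = T t (T s x)) \<and>
     (\<forall>x\<in>topspace \<tau>. T 0 x = x) \<and>
     (\<forall>x\<in>topspace \<tau>. continuous_map (top_of_set {0..}) \<tau> (\<lambda>t. T t x)) \<and>
     (\<exists>\<omega>::real. equicontinuous_operators smul \<tau>
        {\<lambda>x. smul (of_real (exp (\<omega> * t))) (T t x) |t. 0 \<le> t})"

definition generator_domain ::
  "('k::real_normed_field \<Rightarrow> 'a::ab_group_add \<Rightarrow> 'a) \<Rightarrow> 'a topology \<Rightarrow> (real \<Rightarrow> 'a \<Rightarrow> 'a) \<Rightarrow> 'a set" where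
  "generator_domain smul \<tau> T = {x \<in> topspace \<tau>.
     \<exists>y. limitin \<tau> (\<lambda>t. smul (of_real (1 / t)) (T t x - x)) y (at_right 0)}"

definition generator ::
  "('k::real_normed_field \<Rightarrow> 'a::ab_group_add \<Rightarrow> 'a) \<Rightarrow> 'a topology \<Rightarrow> (real \<Rightarrow> 'a \<Rightarrow> 'a) \<Rightarrow> 'a \<Rightarrow> 'a" where
  "generator smul \<tau> T x =
     (THE y. limitin \<tau> (\<lambda>t. smul (of_real (1 / t)) (T t x - x)) y (at_right 0))"

text \<open>
  Level \<open>n\<close> of the tower is the carrier \<open>X\<^sub>n\<close> together with its seminorms \<open>p\<^sub>\<gamma>\<^sub>,\<^sub>n\<close>;
  \<open>X\<^sub>0\<close> is the whole ambient space. All semigroups \<open>T\<^sub>n\<close> are the function \<open>T\<close>, read on the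
  carrier \<open>X\<^sub>n\<close>.
\<close>

primrec sobolev_tower ::
  "('k::real_normed_field \<Rightarrow> 'a::ab_group_add \<Rightarrow> 'a) \<Rightarrow> 'i set \<Rightarrow> ('i \<Rightarrow> 'a \<Rightarrow> real) \<Rightarrow>
     (real \<Rightarrow> 'a \<Rightarrow> 'a) \<Rightarrow> nat \<Rightarrow> 'a set \<times> ('i \<Rightarrow> 'a \<Rightarrow> real)" where
  "sobolev_tower smul \<Gamma> p T 0 = (UNIV, p)"
| "sobolev_tower smul \<Gamma> p T (Suc n) =
     (let (X, q) = sobolev_tower smul \<Gamma> p T n; \<tau> = seminorm_topology X (q ` \<Gamma>)
      in (generator_domain smul \<tau> T, \<lambda>\<gamma> x. q \<gamma> (generator smul \<tau> T x)))"

definition sobolev_space ::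
  "('k::real_normed_field \<Rightarrow> 'a::ab_group_add \<Rightarrow> 'a) \<Rightarrow> 'i set \<Rightarrow> ('i \<Rightarrow> 'a \<Rightarrow> real) \<Rightarrow>
     (real \<Rightarrow> 'a \<Rightarrow> 'a) \<Rightarrow> nat \<Rightarrow> 'a set" where
  "sobolev_space smul \<Gamma> p T n = fst (sobolev_tower smul \<Gamma> p T n)"

definition sobolev_topology ::
  "('k::real_normed_field \<Rightarrow> 'a::ab_group_add \<Rightarrow> 'a) \<Rightarrow> 'i set \<Rightarrow> ('i \<Rightarrow> 'a \<Rightarrow> real) \<Rightarrow>
     (real \<Rightarrow> 'a \<Rightarrow> 'a) \<Rightarrow> nat \<Rightarrow> 'a topology" where
  "sobolev_topology smul \<Gamma> p T n =
     seminorm_topology (sobolev_space smul \<Gamma> p T n) (snd (sobolev_tower smul \<Gamma> p T n) ` \<Gamma>)"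

lemma sobolev_space_0: "sobolev_space smul \<Gamma> p T 0 = UNIV"
  and sobolev_topology_0: "sobolev_topology smul \<Gamma> p T 0 = seminorm_topology UNIV (p ` \<Gamma>)"
  and sobolev_space_Suc: "sobolev_space smul \<Gamma> p T (Suc n) =
        generator_domain smul (sobolev_topology smul \<Gamma> p T n) T"
  by (simp_all add: sobolev_space_def sobolev_topology_def Let_def case_prod_beta)

definition coarsest_inclusion_topology ::
  "('k::real_normed_field \<Rightarrow> 'a::ab_group_add \<Rightarrow> 'a) \<Rightarrow> 'a set \<Rightarrow> (nat \<Rightarrow> 'a topology) \<Rightarrow> 'a topology \<Rightarrow> bool" where
  "coarsest_inclusion_topology smul S \<tau> \<sigma> \<longleftrightarrow>
     topspace \<sigma> = S \<and> locally_convex smul \<sigma> \<and> (\<forall>n. continuous_map \<sigma> (\<tau> n) (\<lambda>x. x)) \<and>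
     (\<forall>\<sigma>'. topspace \<sigma>' = S \<and> locally_convex smul \<sigma>' \<and> (\<forall>n. continuous_map \<sigma>' (\<tau> n) (\<lambda>x. x))
        \<longrightarrow> (\<forall>U. openin \<sigma> U \<longrightarrow> openin \<sigma>' U))"

definition projective_topology ::
  "('k::real_normed_field \<Rightarrow> 'a::ab_group_add \<Rightarrow> 'a) \<Rightarrow> 'a set \<Rightarrow> (nat \<Rightarrow> 'a topology) \<Rightarrow> 'a topology" where
  "projective_topology smul S \<tau> = (THE \<sigma>. coarsest_inclusion_topology smul S \<tau> \<sigma>)"

lemma seminorm_diff:
  assumes vs: "vector_space smul" and S: "module.subspace smul S" and p: "seminorm_on smul S p"
    and "x \<in> S" "y \<in> S" "z \<in> S"
  shows "p (z - x) \<le> p (z - y) + p (y - x)"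
proof -
  interpret vector_space smul by (rule vs)
  have "z - y \<in> S" "y - x \<in> S" using assms by (auto intro: subspace_diff)
  then have "p ((z - y) + (y - x)) \<le> p (z - y) + p (y - x)"
    using p unfolding seminorm_on_def by blast
  then show ?thesis by simp
qed

lemma openin_seminorm_ball:
  assumes vs: "vector_space smul" and S: "module.subspace smul S" and p: "seminorm_on smul S p"
    and "p \<in> P" "x \<in> S"
  shows "openin (seminorm_topology S P) {y\<in>S. p (y - x) < e}"
  unfolding openin_seminorm_topology
proof (intro conjI ballI)
  fix y assume y: "y \<in> {y\<in>S. p (y - x) < e}"
  have "{z\<in>S. \<forall>q\<in>{p}. q (z - y) < e - p (y - x)} \<subseteq> {y\<in>S. p (y - x) < e}"
    using y seminorm_diff[OF vs S p \<open>x \<in> S\<close>, of y] by fastforce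
  then show "\<exists>F d. finite F \<and> F \<subseteq> P \<and> 0 < d \<and> {z\<in>S. \<forall>q\<in>F. q (z - y) < d} \<subseteq> {y\<in>S. p (y - x) < e}"
    using y \<open>p \<in> P\<close> by (intro exI[of _ "{p}"] exI[of _ "e - p (y - x)"]) auto
qed auto

text \<open>
  The coarsest locally convex topology with continuous inclusions exists, so that
  \<open>projective_topology\<close> is well defined: it is given by all the seminorms together.
\<close>

lemma projective_topology_eq:
  fixes X :: "nat \<Rightarrow> 'a::ab_group_add set" and smul :: "'k::real_normed_field \<Rightarrow> 'a \<Rightarrow> 'a"
  assumes vs: "vector_space smul"
    and sub: "\<And>n. module.subspace smul (X n)"
    and sn: "\<And>n p. p \<in> P n \<Longrightarrow> seminorm_on smul (X n) p"
  defines "\<tau> \<equiv> \<lambda>n. seminorm_topology (X n) (P n)"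
  shows "coarsest_inclusion_topology smul (\<Inter>n. X n) \<tau> (seminorm_topology (\<Inter>n. X n) (\<Union>n. P n))"
    and "projective_topology smul (\<Inter>n. X n) \<tau> = seminorm_topology (\<Inter>n. X n) (\<Union>n. P n)"
proof -
  interpret vector_space smul by (rule vs)
  let ?S = "\<Inter>n. X n" and ?Q = "\<Union>n. P n"
  let ?\<sigma> = "seminorm_topology ?S ?Q"
  have subS: "subspace ?S" using sub by (intro subspace_Inter) auto
  have snS: "seminorm_on smul ?S p" if p: "p \<in> ?Q" for p
  proof -
    obtain n where "p \<in> P n" using p by blast
    then show ?thesis using sn[of p n] unfolding seminorm_on_def by simp
  qed
  have "locally_convex smul ?\<sigma>"
    unfolding locally_convex_def using subS snS
    by (intro conjI exI[of _ ?Q]) auto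
  moreover have "continuous_map ?\<sigma> (\<tau> n) (\<lambda>x. x)" for n
    unfolding continuous_map_def
  proof (intro conjI allI impI)
    show "(\<lambda>x. x) \<in> topspace ?\<sigma> \<rightarrow> topspace (\<tau> n)" by (auto simp: \<tau>_def)
  next
    fix U assume U: "openin (\<tau> n) U"
    show "openin ?\<sigma> {x \<in> topspace ?\<sigma>. x \<in> U}"
      unfolding openin_seminorm_topology
    proof (intro conjI ballI)
      fix x assume "x \<in> {x \<in> topspace ?\<sigma>. x \<in> U}"
      then have "x \<in> U" by simp
      then have "\<exists>F e. finite F \<and> F \<subseteq> P n \<and> 0 < e \<and> {y\<in>X n. \<forall>p\<in>F. p (y - x) < e} \<subseteq> U"
        using U by (simp add: \<tau>_def openin_seminorm_topology)
      then obtain F e where F: "finite F" "F \<subseteq> P n" "0 < e" "{y\<in>X n. \<forall>p\<in>F. p (y - x) < e} \<subseteq> U"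
        by (elim exE conjE)
      then have "{y\<in>?S. \<forall>p\<in>F. p (y - x) < e} \<subseteq> {x \<in> topspace ?\<sigma>. x \<in> U}" by auto
      then show "\<exists>F e. finite F \<and> F \<subseteq> ?Q \<and> 0 < e \<and> {y\<in>?S. \<forall>p\<in>F. p (y - x) < e} \<subseteq> {x \<in> topspace ?\<sigma>. x \<in> U}"
        using F(1-3) by (intro exI[of _ F] exI[of _ e]) auto
    qed auto
  qed
  moreover have "openin \<sigma>' U"
    if top: "topspace \<sigma>' = ?S" and cont: "\<And>n. continuous_map \<sigma>' (\<tau> n) (\<lambda>x. x)" and U: "openin ?\<sigma> U"
    for \<sigma>' U
  proof (subst openin_subopen, intro ballI)
    fix x assume "x \<in> U"
    then have "\<exists>F e. finite F \<and> F \<subseteq> ?Q \<and> 0 < e \<and> {y\<in>?S. \<forall>p\<in>F. p (y - x) < e} \<subseteq> U"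
      using U unfolding openin_seminorm_topology by (elim conjE bspec)
    then obtain F e where F: "finite F" "F \<subseteq> ?Q" "0 < e" "{y\<in>?S. \<forall>p\<in>F. p (y - x) < e} \<subseteq> U"
      by (elim exE conjE)
    have xS: "x \<in> ?S" using \<open>x \<in> U\<close> openin_subset[OF U] by auto
    have "openin \<sigma>' {y\<in>topspace \<sigma>'. p (y - x) < e}" if "p \<in> F" for p
    proof -
      obtain n where n: "p \<in> P n" using \<open>p \<in> F\<close> F(2) by blast
      have "openin (\<tau> n) {y\<in>X n. p (y - x) < e}"
        unfolding \<tau>_def using xS by (intro openin_seminorm_ball[OF vs sub sn[OF n] n]) auto
      then have "openin \<sigma>' {y\<in>topspace \<sigma>'. y \<in> {y\<in>X n. p (y - x) < e}}"
        by (rule openin_continuous_map_preimage[OF cont])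
      moreover have "{y\<in>topspace \<sigma>'. y \<in> {y\<in>X n. p (y - x) < e}} = {y\<in>topspace \<sigma>'. p (y - x) < e}"
        using top by auto
      ultimately show ?thesis by simp
    qed
    then have V: "openin \<sigma>' (topspace \<sigma>' \<inter> (\<Inter>p\<in>F. {y\<in>topspace \<sigma>'. p (y - x) < e}))"
      using F(1) by (cases "F = {}") (auto intro!: openin_Int openin_INT)
    have VU: "topspace \<sigma>' \<inter> (\<Inter>p\<in>F. {y\<in>topspace \<sigma>'. p (y - x) < e}) \<subseteq> U"
      using F(4) top by auto
    have p0: "p 0 < e" if "p \<in> F" for p
    proof -
      have "\<forall>c. \<forall>x\<in>?S. p (smul c x) = norm c * p x"
        using snS[OF subsetD[OF F(2) that]] unfolding seminorm_on_def by (rule conjunct2)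
      from bspec[OF spec[OF this, of 0] xS] have "p (smul 0 x) = norm (0::'k) * p x" .
      then show ?thesis using F(3) by simp
    qed
    have xV: "x \<in> topspace \<sigma>' \<inter> (\<Inter>p\<in>F. {y\<in>topspace \<sigma>'. p (y - x) < e})"
      using xS top p0 by simp
    show "\<exists>V. openin \<sigma>' V \<and> x \<in> V \<and> V \<subseteq> U"
      by (intro exI conjI, rule V, rule xV, rule VU)
  qed
  ultimately show c: "coarsest_inclusion_topology smul ?S \<tau> ?\<sigma>"
    unfolding coarsest_inclusion_topology_def by simp
  show "projective_topology smul ?S \<tau> = ?\<sigma>"
    unfolding projective_topology_def
  proof (rule the_equality, rule c)
    fix \<sigma>' assume "coarsest_inclusion_topology smul ?S \<tau> \<sigma>'"
    then show "\<sigma>' = ?\<sigma>"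
      using c unfolding coarsest_inclusion_topology_def topology_eq by metis
  qed
qed

end

(*
  Write A for the generator, R for its inverse and M_h x = (T(h) R x - R x) / h. Then X_n is the range
  of R^n, and A^n carries its topology and semigroup back to X_0, so every assertion except density
  reduces to level 0.

  Density of the intersection of the ranges needs no integration theory: M_h x is the mean of the
  orbit T(r) x over [0,h]. The products M_{h/2} M_{h/4} ... M_{h/2^n} x are averages of T(r) x over
  r in [0,h], and they converge by completeness to some Y(h) x, which tends to x as h tends to 0.
  Since Y(h) = M_{h/2} Y(h/2) and M_h maps the range of R^k into that of R^(k+1), Y(h) x lies in
  every X_n.
*)
theory Submission
  imports Defs
begin

subsection \<open>Seminorm topologies\<close>

text \<open>The standard density argument smooths an orbit with a test function and needs
  vector-valued integrals. Here the only integral is that of the orbit itself, with the closed form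
  \<open>T h (R x) - R x\<close>. One mean gains one level, so a finite product reaches only some
  X_n; an infinite product is what lands in the intersection. Halving the steps makes that product
  converge. The factors after the first n form an iterated mean at scale h/2^n, which moves x little
  by strong continuity. This small difference survives the first n means because the operators
  \<open>T t\<close> with t in [0,1] are equicontinuous; the density proof uses exponential
  equicontinuity only in this local form, whence the restriction h <= 1. The obstacle in the tower
  is that operators are total functions: \<open>A ^^ n\<close> is meaningful only on
  \<open>range (R ^^ n)\<close>. \<open>R\<close> is linear and commutes with \<open>T\<close> on
  the whole space, so identities are proved for \<open>R ^^ n\<close> and read backwards for
  \<open>A ^^ n\<close>.\<close>

lemma seminorm_topology_mono:
  assumes S: "\<And>x y. x \<in> S \<Longrightarrow> y \<in> S \<Longrightarrow> x - y \<in> S"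
    and eq: "\<And>q. q \<in> P \<Longrightarrow> \<exists>q'\<in>P'. \<forall>x\<in>S. q x = q' x"
    and U: "openin (seminorm_topology S P) U"
  shows "openin (seminorm_topology S P') U"
  unfolding openin_seminorm_topology
proof (intro conjI ballI)
  show "U \<subseteq> S" using U by (simp add: openin_seminorm_topology)
  fix x assume x: "x \<in> U"
  then obtain F e where F: "finite F" "F \<subseteq> P" "0 < e" "{y\<in>S. \<forall>q\<in>F. q (y - x) < e} \<subseteq> U"
    using U unfolding openin_seminorm_topology by meson
  obtain g where g: "\<And>q. q \<in> P \<Longrightarrow> g q \<in> P' \<and> (\<forall>x\<in>S. q x = g q x)"
    using eq by metis
  have "x \<in> S" using x \<open>U \<subseteq> S\<close> by blast
  then have "q (y - x) = g q (y - x)" if "q \<in> F" "y \<in> S" for q y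
    using g[of q] F(2) that S by blast
  then have "{y\<in>S. \<forall>q\<in>g ` F. q (y - x) < e} \<subseteq> {y\<in>S. \<forall>q\<in>F. q (y - x) < e}"
    by auto
  then show "\<exists>F e. finite F \<and> F \<subseteq> P' \<and> 0 < e \<and> {y\<in>S. \<forall>q\<in>F. q (y - x) < e} \<subseteq> U"
    using F g by (intro exI[of _ "g ` F"] exI[of _ e]) auto
qed

text \<open>Balls evaluate seminorms only at differences of points of \<open>S\<close>, so only the
  values on \<open>S\<close> matter. This is needed because the recursive seminorms of the tower are
  known to agree with \<open>q \<circ> (A ^^ n)\<close> only on the carrier.\<close>

lemma seminorm_topology_cong:
  assumes "\<And>x y. x \<in> S \<Longrightarrow> y \<in> S \<Longrightarrow> x - y \<in> S"
    and "\<And>q. q \<in> P \<Longrightarrow> \<exists>q'\<in>P'. \<forall>x\<in>S. q x = q' x"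
    and "\<And>q'. q' \<in> P' \<Longrightarrow> \<exists>q\<in>P. \<forall>x\<in>S. q x = q' x"
  shows "seminorm_topology S P = seminorm_topology S P'"
  unfolding topology_eq
proof (intro allI iffI)
  fix U
  show "openin (seminorm_topology S P) U \<Longrightarrow> openin (seminorm_topology S P') U"
    by (rule seminorm_topology_mono[OF assms(1,2)])
  have eq': "\<exists>q\<in>P. \<forall>x\<in>S. q' x = q x" if "q' \<in> P'" for q'
    using assms(3)[OF that] by (simp add: eq_commute)
  show "openin (seminorm_topology S P') U \<Longrightarrow> openin (seminorm_topology S P) U"
    by (rule seminorm_topology_mono[OF assms(1) eq'])
qed

text \<open>Carrier and seminorms are both parameters: the ambient space, every X_n and the
  intersection are instances, so limits and balls are treated once.\<close>

locale seminormed_space = vector_space smul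
  for smul :: "'k::real_normed_field \<Rightarrow> 'a::ab_group_add \<Rightarrow> 'a" (infixr \<open>\<cdot>\<close> 75) +
  fixes S :: "'a set" and P :: "('a \<Rightarrow> real) set"
  assumes subspace: "module.subspace smul S"
    and seminorm: "q \<in> P \<Longrightarrow> seminorm_on smul S q"
begin

lemma seminorm_triangle: "q \<in> P \<Longrightarrow> x \<in> S \<Longrightarrow> y \<in> S \<Longrightarrow> q (x + y) \<le> q x + q y"
  using seminorm unfolding seminorm_on_def by blast

lemma seminorm_scale: "q \<in> P \<Longrightarrow> x \<in> S \<Longrightarrow> q (c \<cdot> x) = norm c * q x"
  using seminorm unfolding seminorm_on_def by blast

lemma seminorm_zero: "q \<in> P \<Longrightarrow> q 0 = 0"
  using seminorm_scale[of q 0 0] subspace_0[OF subspace] by simp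

lemma seminorm_minus: "q \<in> P \<Longrightarrow> x \<in> S \<Longrightarrow> q (- x) = q x"
  using seminorm_scale[of q x "- 1"] by simp

text \<open>Not part of \<open>seminorm_on\<close>; it follows from 0 = q (x + -x) <= 2 q x.\<close>

lemma seminorm_nonneg:
  assumes "q \<in> P" "x \<in> S"
  shows "0 \<le> q x"
proof -
  have "q (x + - x) \<le> q x + q (- x)"
    using assms by (intro seminorm_triangle subspace_neg[OF subspace])
  then show ?thesis
    using seminorm_zero[OF assms(1)] seminorm_minus[OF assms] by simp
qed

lemma locally_convex: "locally_convex smul (seminorm_topology S P)"
  unfolding locally_convex_def using subspace seminorm by auto

lemma openin_ball:
  assumes "finite F" "F \<subseteq> P" "x \<in> S"
  shows "openin (seminorm_topology S P) {y\<in>S. \<forall>q\<in>F. q (y - x) < e}"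
proof -
  have "openin (seminorm_topology S P) {y\<in>S. q (y - x) < e}" if "q \<in> F" for q
    using openin_seminorm_ball[OF vector_space_axioms subspace seminorm] assms that by blast
  then have "openin (seminorm_topology S P)
      (topspace (seminorm_topology S P) \<inter> (\<Inter>q\<in>F. {y\<in>S. q (y - x) < e}))"
    using assms(1)
    \<comment> \<open>For empty \<open>F\<close> the intersection is \<open>UNIV\<close>; the factor
      \<open>topspace\<close> cuts it back to \<open>S\<close>.\<close>
    by (cases "F = {}")
      (simp_all only: openin_topspace openin_Int openin_INT2 image_empty Inter_empty Int_UNIV_right
        simp_thms)
  moreover have "topspace (seminorm_topology S P) \<inter> (\<Inter>q\<in>F. {y\<in>S. q (y - x) < e})
      = {y\<in>S. \<forall>q\<in>F. q (y - x) < e}"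
    by auto
  ultimately show ?thesis by simp
qed

lemma openin_ballE:
  assumes "openin (seminorm_topology S P) U" "x \<in> U"
  obtains F e where "finite F" "F \<subseteq> P" "0 < e" "{y\<in>S. \<forall>q\<in>F. q (y - x) < e} \<subseteq> U"
  using assms unfolding openin_seminorm_topology by meson

text \<open>Finite intersections of seminorm balls form a base, so a limit can be tested one
  seminorm at a time and becomes a limit of reals.\<close>

lemma limitin_iff:
  "limitin (seminorm_topology S P) f l F \<longleftrightarrow>
     l \<in> S \<and> (\<forall>\<^sub>F i in F. f i \<in> S) \<and> (\<forall>q\<in>P. ((\<lambda>i. q (f i - l)) \<longlongrightarrow> 0) F)"
  (is "?L \<longleftrightarrow> ?R")
proof
  assume L: ?L
  then have l: "l \<in> S" by (auto simp: limitin_def)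
  have ev: "\<forall>\<^sub>F i in F. f i \<in> U" if "openin (seminorm_topology S P) U" "l \<in> U" for U
    using L that by (simp add: limitin_def)
  have S: "\<forall>\<^sub>F i in F. f i \<in> S"
    using ev[of S] l openin_topspace[of "seminorm_topology S P"] by simp
  have "((\<lambda>i. q (f i - l)) \<longlongrightarrow> 0) F" if q: "q \<in> P" for q
    unfolding tendsto_iff
  proof (intro allI impI)
    fix e :: real assume e: "0 < e"
    have "\<forall>\<^sub>F i in F. f i \<in> {y\<in>S. \<forall>q\<in>{q}. q (y - l) < e}"
      using openin_ball[of "{q}" l e] q l e seminorm_zero[OF q] by (intro ev) auto
    then show "\<forall>\<^sub>F i in F. dist (q (f i - l)) 0 < e"
      by eventually_elim (use l q seminorm_nonneg subspace_diff[OF subspace] in auto)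
  qed
  with l S show ?R by blast
next
  assume R: ?R
  show ?L
    unfolding limitin_def
  proof (intro conjI allI impI)
    show "l \<in> topspace (seminorm_topology S P)" using R by simp
    fix U assume "openin (seminorm_topology S P) U \<and> l \<in> U"
    then have "openin (seminorm_topology S P) U" "l \<in> U" by blast+
    then obtain G e where G: "finite G" "G \<subseteq> P" "0 < e" "{y\<in>S. \<forall>q\<in>G. q (y - l) < e} \<subseteq> U"
      by (rule openin_ballE)
    have "\<forall>\<^sub>F i in F. \<forall>q\<in>G. q (f i - l) < e"
      using R G(2,3) by (intro eventually_ball_finite G(1)) (auto intro: order_tendstoD(2))
    with conjunct1[OF conjunct2[OF R]] show "\<forall>\<^sub>F i in F. f i \<in> U"
      by eventually_elim (use G(4) in auto)
  qed
qed

lemma limitin_diff: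
  assumes f: "limitin (seminorm_topology S P) f l F" and g: "limitin (seminorm_topology S P) g m F"
  shows "limitin (seminorm_topology S P) (\<lambda>i. f i - g i) (l - m) F"
  unfolding limitin_iff
proof (intro conjI ballI)
  note fg = f[unfolded limitin_iff] g[unfolded limitin_iff]
  show "l - m \<in> S" using fg subspace_diff[OF subspace] by blast
  have fS: "\<forall>\<^sub>F i in F. f i \<in> S" and gS: "\<forall>\<^sub>F i in F. g i \<in> S" using fg by blast+
  then show "\<forall>\<^sub>F i in F. f i - g i \<in> S"
    by eventually_elim (rule subspace_diff[OF subspace])
  fix q assume q: "q \<in> P"
  show "((\<lambda>i. q (f i - g i - (l - m))) \<longlongrightarrow> 0) F"
  proof (rule tendsto_sandwich[of "\<lambda>_. 0"])
    show "\<forall>\<^sub>F i in F. 0 \<le> q (f i - g i - (l - m))"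
      using fS gS by eventually_elim
        (intro seminorm_nonneg subspace_diff[OF subspace] q; use fg in blast)
    show "\<forall>\<^sub>F i in F. q (f i - g i - (l - m)) \<le> q (f i - l) + q (g i - m)"
      using fS gS
    proof eventually_elim
      case (elim i)
      have S: "f i - l \<in> S" "g i - m \<in> S"
        using elim fg by (auto intro: subspace_diff[OF subspace])
      have "f i - g i - (l - m) = (f i - l) + - (g i - m)" by (simp add: algebra_simps)
      then have "q (f i - g i - (l - m)) \<le> q (f i - l) + q (- (g i - m))"
        using seminorm_triangle[OF q S(1), of "- (g i - m)"] S(2) subspace_neg[OF subspace]
        by metis
      then show ?case using seminorm_minus[OF q S(2)] by linarith
    qed
    show "((\<lambda>i. q (f i - l) + q (g i - m)) \<longlongrightarrow> 0) F"
      using fg q by (intro tendsto_add_zero) auto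
  qed auto
qed

lemma limitin_scale:
  assumes f: "limitin (seminorm_topology S P) f l F"
  shows "limitin (seminorm_topology S P) (\<lambda>i. c \<cdot> f i) (c \<cdot> l) F"
  unfolding limitin_iff
proof (intro conjI ballI)
  note f' = f[unfolded limitin_iff]
  show "c \<cdot> l \<in> S" using f' subspace_scale[OF subspace] by blast
  have fS: "\<forall>\<^sub>F i in F. f i \<in> S" using f' by blast
  then show "\<forall>\<^sub>F i in F. c \<cdot> f i \<in> S"
    by eventually_elim (rule subspace_scale[OF subspace])
  fix q assume q: "q \<in> P"
  have "((\<lambda>i. norm c * q (f i - l)) \<longlongrightarrow> 0) F"
    using f' q by (intro tendsto_mult_right_zero) auto
  moreover have "\<forall>\<^sub>F i in F. norm c * q (f i - l) = q (c \<cdot> f i - c \<cdot> l)"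
    using fS
  proof eventually_elim
    case (elim i)
    then have "f i - l \<in> S" using f' subspace_diff[OF subspace] by blast
    from seminorm_scale[OF q this] show ?case by (simp add: scale_right_diff_distrib)
  qed
  ultimately show "((\<lambda>i. q (c \<cdot> f i - c \<cdot> l)) \<longlongrightarrow> 0) F"
    by (rule Lim_transform_eventually)
qed

lemma limitin_add:
  assumes "limitin (seminorm_topology S P) f l F" "limitin (seminorm_topology S P) g m F"
  shows "limitin (seminorm_topology S P) (\<lambda>i. f i + g i) (l + m) F"
  using limitin_diff[OF assms(1) limitin_scale[OF assms(2), of "- 1"]] by simp

end

subsection \<open>Semigroups with invertible generator\<close>

locale invertible_generator = seminormed_space smul UNIV P
  for smul :: "'k::real_normed_field \<Rightarrow> 'a::ab_group_add \<Rightarrow> 'a" (infixr \<open>\<cdot>\<close> 75)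
    and P :: "('a \<Rightarrow> real) set" +
  fixes T :: "real \<Rightarrow> 'a \<Rightarrow> 'a"
  assumes Hausdorff: "Hausdorff_space (seminorm_topology UNIV P)"
    and complete: "complete_locally_convex smul (seminorm_topology UNIV P)"
    and semigroup: "sc_exp_equicontinuous_semigroup smul (seminorm_topology UNIV P) T"
    and bij: "bij_betw (generator smul (seminorm_topology UNIV P) T)
      (generator_domain smul (seminorm_topology UNIV P) T) UNIV"
    and cont_inv: "continuous_map (seminorm_topology UNIV P) (seminorm_topology UNIV P)
      (inv_into (generator_domain smul (seminorm_topology UNIV P) T)
        (generator smul (seminorm_topology UNIV P) T))"
begin

abbreviation "\<tau>\<^sub>0 \<equiv> seminorm_topology UNIV P"

definition "D = generator_domain smul \<tau>\<^sub>0 T"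

definition "A = generator smul \<tau>\<^sub>0 T"

text \<open>Since \<open>A\<close> maps \<open>D\<close> onto \<open>UNIV\<close>, this inverse and
  all its powers are meaningful on the whole space, unlike the powers of \<open>A\<close>.\<close>

definition "R = inv_into D A"

text \<open>Kept apart from \<open>R\<close> because it serves twice: its limit at 0 is the
  generator, and \<open>quot h (R x)\<close> is the mean M_h x of the overview.\<close>

definition quot :: "real \<Rightarrow> 'a \<Rightarrow> 'a" where
  "quot t x = of_real (1 / t) \<cdot> (T t x - x)"

lemma
  assumes "0 \<le> t"
  shows T_add: "T t (x + y) = T t x + T t y" and T_scale: "T t (c \<cdot> x) = c \<cdot> T t x"
    and T_cont: "continuous_map \<tau>\<^sub>0 \<tau>\<^sub>0 (T t)"
proof -
  have "\<forall>t\<ge>0. T t \<in> continuous_operators smul \<tau>\<^sub>0"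
    using semigroup unfolding sc_exp_equicontinuous_semigroup_def by (rule conjunct1)
  with assms have "T t \<in> continuous_operators smul \<tau>\<^sub>0" by blast
  then show "T t (x + y) = T t x + T t y" "T t (c \<cdot> x) = c \<cdot> T t x"
    "continuous_map \<tau>\<^sub>0 \<tau>\<^sub>0 (T t)"
    by (simp_all add: continuous_operators_def linear_on_carrier_def)
qed

lemma T_diff: "0 \<le> t \<Longrightarrow> T t (x - y) = T t x - T t y"
  using T_add[of t "x - y" y] by simp

lemma T_plus: "0 \<le> t \<Longrightarrow> 0 \<le> s \<Longrightarrow> T (t + s) x = T t (T s x)"
  and T_zero: "T 0 x = x"
  and T_strongly_cont: "continuous_map (top_of_set {0..}) \<tau>\<^sub>0 (\<lambda>t. T t x)"
  using semigroup unfolding sc_exp_equicontinuous_semigroup_def topspace_seminorm_topology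
  by blast+

lemma equicontinuous:
  obtains \<omega> where
    "equicontinuous_operators smul \<tau>\<^sub>0 {\<lambda>x. of_real (exp (\<omega> * t)) \<cdot> T t x |t. 0 \<le> t}"
  using semigroup unfolding sc_exp_equicontinuous_semigroup_def by blast

lemma T_commute: "0 \<le> t \<Longrightarrow> 0 \<le> s \<Longrightarrow> T t (T s x) = T s (T t x)"
  by (metis T_plus add.commute)

lemma limitin_unique: "limitin \<tau>\<^sub>0 f l F \<Longrightarrow> limitin \<tau>\<^sub>0 f m F \<Longrightarrow> F \<noteq> bot \<Longrightarrow> l = m"
  by (rule limitin_Hausdorff_unique[OF _ _ _ Hausdorff])

text \<open>The Hausdorff property makes the limit unique, which the definite description in
  \<open>generator\<close> requires.\<close>

lemma generatorI:
  assumes "limitin \<tau>\<^sub>0 (\<lambda>t. quot t x) y (at_right 0)"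
  shows "x \<in> D" "A x = y"
proof -
  show "x \<in> D"
    using assms unfolding D_def generator_domain_def quot_def by auto
  show "A x = y"
    unfolding A_def generator_def quot_def[symmetric]
    by (rule the_equality, rule assms, erule limitin_unique[OF _ assms], simp)
qed

lemma generator_limit:
  assumes "x \<in> D"
  shows "limitin \<tau>\<^sub>0 (\<lambda>t. quot t x) (A x) (at_right 0)"
proof -
  obtain y where "limitin \<tau>\<^sub>0 (\<lambda>t. quot t x) y (at_right 0)"
    using assms unfolding D_def generator_domain_def quot_def by auto
  moreover from this have "A x = y" by (rule generatorI(2))
  ultimately show ?thesis by simp
qed

lemma eventually_at_right_0: "\<forall>\<^sub>F t in at_right (0::real). 0 < t"
  by (rule eventually_at_right_less)

lemma limitin_cong_right:
  assumes "limitin \<tau>\<^sub>0 f l (at_right (0::real))" "\<And>t. 0 < t \<Longrightarrow> f t = g t"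
  shows "limitin \<tau>\<^sub>0 g l (at_right 0)"
  by (rule limitin_transform_eventually[OF _ assms(1)], rule eventually_mono[OF eventually_at_right_0])
    (rule assms(2))

lemma quot_add: "0 < t \<Longrightarrow> quot t (x + y) = quot t x + quot t y"
  by (simp add: quot_def T_add scale_right_diff_distrib scale_right_distrib)

lemma quot_scale: "0 < t \<Longrightarrow> quot t (c \<cdot> x) = c \<cdot> quot t x"
  by (simp add: quot_def T_scale scale_right_diff_distrib mult.commute)

lemma quot_T: "0 < t \<Longrightarrow> 0 \<le> s \<Longrightarrow> quot t (T s x) = T s (quot t x)"
  by (simp add: quot_def T_scale T_diff T_commute)

section \<open>Linearity of the generator and of its inverse, and commutation with the
  semigroup\<close>

lemma A_add:
  assumes "x \<in> D" "y \<in> D"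
  shows "x + y \<in> D \<and> A (x + y) = A x + A y"
proof -
  have "limitin \<tau>\<^sub>0 (\<lambda>t. quot t (x + y)) (A x + A y) (at_right 0)"
    by (rule limitin_cong_right[OF limitin_add[OF generator_limit generator_limit]])
      (simp_all add: assms quot_add)
  then show ?thesis using generatorI by blast
qed

lemma A_scale:
  assumes "x \<in> D"
  shows "c \<cdot> x \<in> D \<and> A (c \<cdot> x) = c \<cdot> A x"
proof -
  have "limitin \<tau>\<^sub>0 (\<lambda>t. quot t (c \<cdot> x)) (c \<cdot> A x) (at_right 0)"
    by (rule limitin_cong_right[OF limitin_scale[OF generator_limit]])
      (simp_all add: assms quot_scale)
  then show ?thesis using generatorI by blast
qed

text \<open>\<open>T s\<close> is continuous and commutes with the difference quotients, so it
  carries their limit along.\<close>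

lemma A_T:
  assumes "x \<in> D" "0 \<le> s"
  shows "T s x \<in> D \<and> A (T s x) = T s (A x)"
proof -
  have "limitin \<tau>\<^sub>0 (T s \<circ> (\<lambda>t. quot t x)) (T s (A x)) (at_right 0)"
    by (rule continuous_map_limit[OF T_cont[OF assms(2)] generator_limit[OF assms(1)]])
  then have "limitin \<tau>\<^sub>0 (\<lambda>t. quot t (T s x)) (T s (A x)) (at_right 0)"
    by (rule limitin_cong_right) (simp add: quot_T assms(2))
  then show ?thesis using generatorI by blast
qed

lemma R_in_D: "R x \<in> D" and A_R [simp]: "A (R x) = x" and R_A: "x \<in> D \<Longrightarrow> R (A x) = x"
  and R_cont: "continuous_map \<tau>\<^sub>0 \<tau>\<^sub>0 R"
proof -
  have b: "bij_betw A D UNIV" using bij by (simp add: A_def D_def)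
  then have s: "A ` D = UNIV" by (simp add: bij_betw_def)
  then show "R x \<in> D" "A (R x) = x"
    unfolding R_def by (simp_all add: inv_into_into f_inv_into_f)
  show "x \<in> D \<Longrightarrow> R (A x) = x"
    unfolding R_def using b by (simp add: bij_betw_def inv_into_f_f)
  show "continuous_map \<tau>\<^sub>0 \<tau>\<^sub>0 R"
    using cont_inv by (simp add: R_def A_def D_def)
qed

lemma range_R: "range R = D"
proof
  show "range R \<subseteq> D" using R_in_D by blast
  show "D \<subseteq> range R" using R_A[symmetric] by blast
qed

lemma R_add: "R (x + y) = R x + R y"
  using A_add[OF R_in_D R_in_D, of x y] R_A[of "R x + R y"] by simp

lemma R_scale: "R (c \<cdot> x) = c \<cdot> R x"
  using A_scale[OF R_in_D, of c x] R_A[of "c \<cdot> R x"] by simp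

lemma R_diff: "R (x - y) = R x - R y"
  using R_add[of "x - y" y] by simp

lemma R_T: "0 \<le> s \<Longrightarrow> R (T s x) = T s (R x)"
  using A_T[OF R_in_D, of s x] R_A[of "T s (R x)"] by simp

lemma R_quot: "0 < t \<Longrightarrow> R (quot t x) = quot t (R x)"
  by (simp add: quot_def R_scale R_diff R_T)

section \<open>Powers of \<open>R\<close> and \<open>A\<close>, and the subspaces
  \<open>range (R ^^ n)\<close>\<close>

lemma Rn_add: "(R ^^ n) (x + y) = (R ^^ n) x + (R ^^ n) y"
  by (induction n) (auto simp: R_add)

lemma Rn_scale: "(R ^^ n) (c \<cdot> x) = c \<cdot> (R ^^ n) x"
  by (induction n) (auto simp: R_scale)

lemma Rn_diff: "(R ^^ n) (x - y) = (R ^^ n) x - (R ^^ n) y"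
  by (induction n) (auto simp: R_diff)

lemma Rn_zero: "(R ^^ n) 0 = 0"
  using Rn_scale[of n 0 0] by simp

lemma Rn_T: "0 \<le> s \<Longrightarrow> (R ^^ n) (T s x) = T s ((R ^^ n) x)"
  by (induction n) (auto simp: R_T)

lemma Rn_quot: "0 < t \<Longrightarrow> (R ^^ n) (quot t x) = quot t ((R ^^ n) x)"
  by (induction n) (auto simp: R_quot)

lemma An_Rn [simp]: "(A ^^ n) ((R ^^ n) x) = x"
  by (induction n arbitrary: x) (auto simp: funpow_swap1)

lemma An_zero: "(A ^^ n) 0 = 0"
  using An_Rn[of n 0] by (simp only: Rn_zero)

lemma Rn_An: "x \<in> range (R ^^ n) \<Longrightarrow> (R ^^ n) ((A ^^ n) x) = x"
  by auto

lemma range_Rn_mono: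
  assumes "m \<le> n"
  shows "range (R ^^ n) \<subseteq> range (R ^^ m)"
proof -
  obtain k where "n = m + k" using assms le_Suc_ex by blast
  then show ?thesis by (auto simp: funpow_add)
qed

text \<open>The recursion X_{n+1} = D(A_n) expressed at level 0: \<open>A ^^ n\<close> turns the
  domain of the generator on X_n into \<open>D\<close>.\<close>

lemma range_Rn_Suc: "x \<in> range (R ^^ Suc n) \<longleftrightarrow> x \<in> range (R ^^ n) \<and> (A ^^ n) x \<in> D"
proof
  assume "x \<in> range (R ^^ Suc n)"
  then obtain y where "x = (R ^^ n) (R y)" by (auto simp: funpow_swap1)
  then show "x \<in> range (R ^^ n) \<and> (A ^^ n) x \<in> D" using R_in_D by simp
next
  assume x: "x \<in> range (R ^^ n) \<and> (A ^^ n) x \<in> D"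
  then obtain z where "(A ^^ n) x = R z" using range_R by blast
  then have "x = (R ^^ Suc n) z" using Rn_An x funpow_swap1 by (metis comp_apply funpow.simps(2))
  then show "x \<in> range (R ^^ Suc n)" by blast
qed

text \<open>Writing x as \<open>(R ^^ n) y\<close> reduces each claim to an identity for
  \<open>R ^^ n\<close>. Off the range nothing is known about \<open>A ^^ n\<close>.\<close>

lemma
  assumes "x \<in> range (R ^^ n)"
  shows T_range_Rn: "0 \<le> s \<Longrightarrow> T s x \<in> range (R ^^ n)"
    and An_T: "0 \<le> s \<Longrightarrow> (A ^^ n) (T s x) = T s ((A ^^ n) x)"
    and scale_range_Rn: "c \<cdot> x \<in> range (R ^^ n)"
    and An_scale: "(A ^^ n) (c \<cdot> x) = c \<cdot> (A ^^ n) x"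
    and quot_range_Rn: "0 < t \<Longrightarrow> quot t x \<in> range (R ^^ n)"
    and An_quot: "0 < t \<Longrightarrow> (A ^^ n) (quot t x) = quot t ((A ^^ n) x)"
proof -
  obtain y where y: "x = (R ^^ n) y" using assms by blast
  show "0 \<le> s \<Longrightarrow> T s x \<in> range (R ^^ n)" "0 \<le> s \<Longrightarrow> (A ^^ n) (T s x) = T s ((A ^^ n) x)"
    "c \<cdot> x \<in> range (R ^^ n)" "(A ^^ n) (c \<cdot> x) = c \<cdot> (A ^^ n) x"
    "0 < t \<Longrightarrow> quot t x \<in> range (R ^^ n)" "0 < t \<Longrightarrow> (A ^^ n) (quot t x) = quot t ((A ^^ n) x)"
    unfolding y by (simp_all flip: Rn_T Rn_scale Rn_quot)
qed

lemma
  assumes "x \<in> range (R ^^ n)" "y \<in> range (R ^^ n)"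
  shows add_range_Rn: "x + y \<in> range (R ^^ n)"
    and An_add: "(A ^^ n) (x + y) = (A ^^ n) x + (A ^^ n) y"
    and diff_range_Rn: "x - y \<in> range (R ^^ n)"
    and An_diff: "(A ^^ n) (x - y) = (A ^^ n) x - (A ^^ n) y"
proof -
  obtain u v where uv: "x = (R ^^ n) u" "y = (R ^^ n) v" using assms by blast
  show "x + y \<in> range (R ^^ n)" "(A ^^ n) (x + y) = (A ^^ n) x + (A ^^ n) y"
    "x - y \<in> range (R ^^ n)" "(A ^^ n) (x - y) = (A ^^ n) x - (A ^^ n) y"
    unfolding uv by (simp_all flip: Rn_add Rn_diff)
qed

lemma subspace_range_Rn: "module.subspace smul (range (R ^^ n))"
proof (rule subspaceI)
  show "0 \<in> range (R ^^ n)" using Rn_zero by (metis rangeI)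
qed (auto intro: add_range_Rn scale_range_Rn)

end

subsection \<open>Density of the universal interpolation space\<close>

context invertible_generator
begin

text \<open>On [0,1] the weight exp (\<omega> t) lies between two positive constants, so it can be
  removed from the equicontinuous family.\<close>

lemma equicontinuous_unit_interval:
  assumes q: "q \<in> P" and e: "0 < e"
  obtains F d where "finite F" "F \<subseteq> P" "0 < d"
    "\<And>x t. \<lbrakk>\<And>f. f \<in> F \<Longrightarrow> f x < d; 0 \<le> t; t \<le> 1\<rbrakk> \<Longrightarrow> q (T t x) \<le> e"
proof -
  obtain \<omega> where "equicontinuous_operators smul \<tau>\<^sub>0 {\<lambda>x. of_real (exp (\<omega> * t)) \<cdot> T t x |t. 0 \<le> t}"
    by (rule equicontinuous)
  then have eq: "\<forall>V. openin \<tau>\<^sub>0 V \<and> 0 \<in> V \<longrightarrow> (\<exists>U. openin \<tau>\<^sub>0 U \<and> 0 \<in> U \<and>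
      (\<forall>f\<in>{\<lambda>x. of_real (exp (\<omega> * t)) \<cdot> T t x |t. 0 \<le> t}. f ` U \<subseteq> V))"
    unfolding equicontinuous_operators_def by (rule conjunct2)
  \<comment> \<open>Dividing by the weight costs a factor exp (-\<omega> t) <= exp |\<omega>| on
    [0,1], which turns c back into e.\<close>
  define c where "c = e * exp (- \<bar>\<omega>\<bar>)"
  let ?V = "{y\<in>UNIV. \<forall>f\<in>{q}. f (y - 0) < c}"
  have c: "0 < c" using e by (simp add: c_def)
  have "openin \<tau>\<^sub>0 ?V \<and> 0 \<in> ?V"
    using openin_ball[of "{q}" 0 c] q c seminorm_zero[OF q] by simp
  then obtain U where U: "openin \<tau>\<^sub>0 U" "0 \<in> U"
    "\<forall>f\<in>{\<lambda>x. of_real (exp (\<omega> * t)) \<cdot> T t x |t. 0 \<le> t}. f ` U \<subseteq> ?V"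
    using eq by meson
  obtain F d where F: "finite F" "F \<subseteq> P" "0 < d" "{y\<in>UNIV. \<forall>q\<in>F. q (y - 0) < d} \<subseteq> U"
    using U(1,2) by (rule openin_ballE)
  have "q (T t x) \<le> e" if x: "\<And>f. f \<in> F \<Longrightarrow> f x < d" and t: "0 \<le> t" "t \<le> 1" for x t
  proof -
    have "x \<in> U" using F(4) x by auto
    moreover have "\<forall>x\<in>U. of_real (exp (\<omega> * t)) \<cdot> T t x \<in> ?V"
      unfolding image_subset_iff[symmetric] by (rule bspec[OF U(3)]) (use t(1) in blast)
    ultimately have "of_real (exp (\<omega> * t)) \<cdot> T t x \<in> ?V"
      by (rule_tac bspec)
    then have "exp (\<omega> * t) * q (T t x) < c"
      using q by (simp add: seminorm_scale)
    then have "exp (- (\<omega> * t)) * (exp (\<omega> * t) * q (T t x)) \<le> exp (- (\<omega> * t)) * c"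
      by simp
    moreover have "exp (- (\<omega> * t)) * (exp (\<omega> * t) * q (T t x)) = q (T t x)"
      by (simp add: exp_minus field_simps)
    moreover have "- (\<omega> * t) \<le> \<bar>\<omega>\<bar>"
    proof -
      have "- (\<omega> * t) \<le> \<bar>\<omega>\<bar> * t" using t(1) by (metis abs_ge_minus_self abs_mult abs_of_nonneg)
      also have "\<dots> \<le> \<bar>\<omega>\<bar>" using t by (simp add: mult_left_le)
      finally show ?thesis .
    qed
    then have "exp (- (\<omega> * t)) * c \<le> exp \<bar>\<omega>\<bar> * c"
      using c by simp
    moreover have "exp \<bar>\<omega>\<bar> * c = e"
      by (simp add: c_def exp_minus)
    ultimately show ?thesis by linarith
  qed
  with F(1-3) show ?thesis by (rule that)
qed

lemma quot_R_limit: "limitin \<tau>\<^sub>0 (\<lambda>t. quot t (R x)) x (at_right 0)"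
  using generator_limit[OF R_in_D, of x] by simp

text \<open>
  Riemann sums stand in for the integral of the orbit of \<open>x\<close> over \<open>[0, h]\<close>, which is \<open>T h (R x) - R x\<close>.
\<close>

lemma mean_bound:
  assumes q: "q \<in> P" and h: "0 < h" "h \<le> 1"
    and bound: "\<And>r. 0 \<le> r \<Longrightarrow> r \<le> h \<Longrightarrow> q (T r x - v) \<le> e"
  shows "q (quot h (R x) - v) \<le> e"
\<comment> \<open>The slack c pays for replacing x by \<open>quot t (R x)\<close> at the mesh size
  t.\<close>
proof (rule field_le_epsilon)
  fix c :: real assume c: "0 < c"
  obtain F d where F: "finite F" "F \<subseteq> P" "0 < d"
    "\<And>x t. \<lbrakk>\<And>f. f \<in> F \<Longrightarrow> f x < d; 0 \<le> t; t \<le> 1\<rbrakk> \<Longrightarrow> q (T t x) \<le> c"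
    using equicontinuous_unit_interval[OF q c] by metis
  have "\<forall>\<^sub>F t in at_right 0. \<forall>f\<in>F. f (quot t (R x) - x) < d"
    using quot_R_limit[of x] F(2,3) unfolding limitin_iff
    by (intro eventually_ball_finite F(1)) (auto intro: order_tendstoD(2))
  then obtain b where b: "0 < b" "\<And>t f. 0 < t \<Longrightarrow> t < b \<Longrightarrow> f \<in> F \<Longrightarrow> f (quot t (R x) - x) < d"
    unfolding eventually_at_right_field by auto
  \<comment> \<open>Makes the mesh t = h/n smaller than b, where \<open>quot t (R x)\<close> is
    already close to x.\<close>
  obtain n :: nat where n: "h / b < real n"
    using reals_Archimedean2 by blast
  then have "0 < n" using h(1) b(1) by (cases n) (auto simp: divide_less_0_iff)
  define t where "t = h / n"
  have t: "0 < t" "t < b" "n * t = h"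
    using \<open>0 < n\<close> h(1) n b(1) by (auto simp: t_def field_simps)
  \<comment> \<open>The increment of \<open>T s (R x)\<close> from s = j t to (j + 1) t is t times
    \<open>T (j * t) (quot t (R x))\<close>. That vector is within c of \<open>T (j * t) x\<close>
    by equicontinuity, which is within e of v by assumption; the errors add up linearly in
    j.\<close>
  have step: "q (T (j * t) (R x) - R x - of_real (j * t) \<cdot> v) \<le> (j * t) * (e + c)"
    if "j \<le> n" for j :: nat
    using that
  proof (induction j)
    case 0
    then show ?case by (simp add: T_zero seminorm_zero q)
  next
    case (Suc j)
    let ?s = "j * t"
    have s: "0 \<le> ?s" using t(1) by simp
    have "?s \<le> n * t" using Suc.prems t(1) by (intro mult_right_mono) auto
    then have sh: "?s \<le> h" using t(3) by simp
    let ?a = "T ?s (R x) - R x - of_real ?s \<cdot> v"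
    let ?b = "T ?s (quot t (R x) - x)" and ?c = "T ?s x - v"
    have e1: "of_real t \<cdot> T ?s (quot t (R x)) = T ?s (T t (R x)) - T ?s (R x)"
      using t(1) s by (simp add: quot_def T_scale T_diff)
    have "T (Suc j * t) (R x) = T ?s (T t (R x))"
      using T_plus[OF s, of t "R x"] t(1) by (simp add: algebra_simps)
    then have split: "T (Suc j * t) (R x) - R x - of_real (Suc j * t) \<cdot> v = ?a + of_real t \<cdot> (?b + ?c)"
      using e1 s by (simp add: T_diff scale_right_distrib scale_right_diff_distrib algebra_simps)
    have "q (T (Suc j * t) (R x) - R x - of_real (Suc j * t) \<cdot> v)
        \<le> q ?a + q (of_real t \<cdot> (?b + ?c))"
      unfolding split by (rule seminorm_triangle[OF q]) simp_all
    also have "\<dots> \<le> q ?a + t * (q ?b + q ?c)"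
      using seminorm_triangle[OF q, of ?b ?c] t(1) by (simp add: seminorm_scale[OF q])
    also have "\<dots> \<le> ?s * (e + c) + t * (c + e)"
    proof (intro add_mono mult_left_mono)
      show "q ?a \<le> ?s * (e + c)" using Suc by simp
      show "q ?b \<le> c" by (rule F(4)) (use b(2)[OF t(1,2)] s sh h(2) in auto)
      show "q ?c \<le> e" using bound[OF s sh] .
    qed (use t(1) in simp)
    also have "\<dots> = (Suc j * t) * (e + c)" by (simp add: algebra_simps)
    finally show ?case .
  qed
  have "quot h (R x) - v = of_real (1 / h) \<cdot> (T h (R x) - R x - of_real h \<cdot> v)"
    using h(1) by (simp add: quot_def scale_right_diff_distrib)
  then have "q (quot h (R x) - v) = q (T h (R x) - R x - of_real h \<cdot> v) / h"
    using h(1) by (simp add: seminorm_scale[OF q] norm_divide)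
  also have "\<dots> \<le> h * (e + c) / h"
    using step[of n] t(3) h(1) by (intro divide_right_mono) auto
  also have "\<dots> = e + c" using h(1) by simp
  finally show "q (quot h (R x) - v) \<le> e + c" .
qed

text \<open>The longest step is outermost and the rest is the same construction at scale h/2, which
  gives the limit its self-similarity. The steps h/2, h/4, ... sum to less than h, so only orbit
  points with times in [0,h] are averaged.\<close>

primrec iterated_mean :: "nat \<Rightarrow> real \<Rightarrow> 'a \<Rightarrow> 'a" where
  "iterated_mean 0 h x = x"
| "iterated_mean (Suc n) h x = quot (h / 2) (R (iterated_mean n (h / 2) x))"

lemma quot_diff: "0 < t \<Longrightarrow> quot t (x - y) = quot t x - quot t y"
  using quot_add[of t "x - y" y] by simp

lemma iterated_mean_diff:
  "0 < h \<Longrightarrow> iterated_mean n h (x - y) = iterated_mean n h x - iterated_mean n h y"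
  by (induction n arbitrary: h) (simp_all add: R_diff quot_diff)

lemma iterated_mean_T:
  "0 < h \<Longrightarrow> 0 \<le> s \<Longrightarrow> iterated_mean n h (T s x) = T s (iterated_mean n h x)"
  by (induction n arbitrary: h) (simp_all add: R_T quot_T)

text \<open>Splits off the tail of the product, itself an iterated mean at scale h/2^n; this is what
  the Cauchy estimate compares with x.\<close>

lemma iterated_mean_add:
  "iterated_mean (n + m) h x = iterated_mean n h (iterated_mean m (h / 2 ^ n) x)"
  by (induction n arbitrary: h) (simp_all add: mult.commute)

text \<open>A closed seminorm ball containing the orbit over [0,h] contains its averages, with no
  loss however many means are taken.\<close>

lemma iterated_mean_bound:
  assumes q: "q \<in> P" and "0 < h" "h \<le> 1"
    and "\<And>r. 0 \<le> r \<Longrightarrow> r \<le> h \<Longrightarrow> q (T r x - v) \<le> e"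
  shows "q (iterated_mean n h x - v) \<le> e"
  using assms(2-)
proof (induction n arbitrary: h x)
  case 0
  then show ?case using "0.prems"(3)[of 0] by (simp add: T_zero)
next
  case (Suc n)
  have "q (quot (h / 2) (R (iterated_mean n (h / 2) x)) - v) \<le> e"
  proof (rule mean_bound[OF q])
    fix r assume r: "0 \<le> r" "r \<le> h / 2"
    \<comment> \<open>The outer mean spends time r <= h/2 and the inner ones s <= h/2. Moving
      \<open>T r\<close> inside makes the orbit points \<open>T (s + r) x\<close>, still within
      [0,h].\<close>
    have "q (iterated_mean n (h / 2) (T r x) - v) \<le> e"
    proof (rule Suc.IH)
      fix s assume "0 \<le> s" "s \<le> h / 2"
      then show "q (T s (T r x) - v) \<le> e"
        using Suc.prems(3)[of "s + r"] r by (simp add: T_plus)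
    qed (use Suc.prems in auto)
    then show "q (T r (iterated_mean n (h / 2) x) - v) \<le> e"
      using Suc.prems(1) r(1) by (simp add: iterated_mean_T)
  qed (use Suc.prems in auto)
  then show ?case by simp
qed

lemma T_strongly_cont_0:
  assumes q: "q \<in> P" and e: "0 < e"
  shows "\<forall>\<^sub>F h in at_right 0. \<forall>r\<in>{0..h}. q (T r x - x) \<le> e"
proof -
  have "openin \<tau>\<^sub>0 {y\<in>UNIV. \<forall>f\<in>{q}. f (y - x) < e}"
    using q by (intro openin_ball) auto
  then have "openin (top_of_set {0..})
      {t \<in> topspace (top_of_set {0..}). T t x \<in> {y\<in>UNIV. \<forall>f\<in>{q}. f (y - x) < e}}"
    by (rule openin_continuous_map_preimage[OF T_strongly_cont])
  moreover have "0 \<in> {t \<in> topspace (top_of_set {0..}). T t x \<in> {y\<in>UNIV. \<forall>f\<in>{q}. f (y - x) < e}}"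
    using e by (simp add: T_zero seminorm_zero q)
  ultimately obtain d where d: "0 < d"
      "ball 0 d \<inter> {0..} \<subseteq> {t \<in> topspace (top_of_set {0..}). T t x \<in> {y\<in>UNIV. \<forall>f\<in>{q}. f (y - x) < e}}"
    unfolding openin_contains_ball by blast
  have "q (T r x - x) \<le> e" if "0 \<le> r" "r < d" for r
    using subsetD[OF d(2), of r] that by (simp add: dist_real_def)
  then show ?thesis
    unfolding eventually_at_right_field using d(1) by (intro exI[of _ d]) auto
qed

text \<open>Completeness is stated for filters and is applied to the image filter of the sequence.
  Comparison with one reference term suffices, since two such comparisons bound any difference in
  the tail.\<close>

lemma sequentially_complete:
  assumes "\<And>q e. q \<in> P \<Longrightarrow> 0 < e \<Longrightarrow> \<exists>n. \<forall>k. q (u (n + k) - u n) \<le> (e::real)"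
  shows "\<exists>l. limitin \<tau>\<^sub>0 u l sequentially"
proof -
  have "cauchy_filter_in \<tau>\<^sub>0 (filtermap u sequentially)"
    unfolding cauchy_filter_in_def
  proof (intro conjI allI impI)
    fix V assume "openin \<tau>\<^sub>0 V \<and> 0 \<in> V"
    then have "openin \<tau>\<^sub>0 V" "0 \<in> V" by blast+
    then obtain F e where F: "finite F" "F \<subseteq> P" "0 < e" "{y\<in>UNIV. \<forall>q\<in>F. q (y - 0) < e} \<subseteq> V"
      by (rule openin_ballE)
    have "\<forall>\<^sub>F (i, j) in sequentially \<times>\<^sub>F sequentially. q (u i - u j) < e" if "q \<in> F" for q
    proof -
      have q: "q \<in> P" using that F(2) by blast
      obtain n where n: "\<And>k. q (u (n + k) - u n) \<le> e / 3"
        using assms[OF q, of "e / 3"] F(3) by auto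
      have "q (u i - u j) < e" if "n \<le> i" "n \<le> j" for i j
      proof -
        have "q (u i - u n) \<le> e / 3" "q (u j - u n) \<le> e / 3"
          using n[of "i - n"] n[of "j - n"] that by simp_all
        moreover have "q ((u i - u n) + - (u j - u n)) \<le> q (u i - u n) + q (- (u j - u n))"
          by (rule seminorm_triangle[OF q]) simp_all
        moreover have "(u i - u n) + - (u j - u n) = u i - u j" by simp
        ultimately show ?thesis
          using seminorm_minus[OF q, of "u j - u n"] F(3) by simp
      qed
      then show ?thesis unfolding eventually_prod_sequentially by auto
    qed
    then have "\<forall>\<^sub>F z in sequentially \<times>\<^sub>F sequentially. \<forall>q\<in>F. q (u (fst z) - u (snd z)) < e"
      by (intro eventually_ball_finite F(1)) (auto simp: case_prod_unfold)
    then have "\<forall>\<^sub>F z in sequentially \<times>\<^sub>F sequentially. u (fst z) - u (snd z) \<in> V"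
      by (rule eventually_mono) (use F(4) in auto)
    then show "\<forall>\<^sub>F (x, y) in filtermap u sequentially \<times>\<^sub>F filtermap u sequentially. x - y \<in> V"
      by (simp add: prod_filtermap1 prod_filtermap2 eventually_filtermap case_prod_unfold)
  qed (simp_all add: filtermap_bot_iff)
  then obtain l where "limitin \<tau>\<^sub>0 (\<lambda>y. y) l (filtermap u sequentially)"
    using complete unfolding complete_locally_convex_def by blast
  then show ?thesis
    unfolding limitin_def eventually_filtermap by blast
qed

text \<open>By \<open>iterated_mean_add\<close> and linearity, the terms n + k and n differ by the
  n-fold mean of z - x, where z is a k-fold mean at scale h/2^n. Strong continuity makes z - x small
  for large n, uniformly in k.\<close>

lemma iterated_mean_limit:
  assumes h: "0 < h" "h \<le> 1"
  shows "\<exists>y. limitin \<tau>\<^sub>0 (\<lambda>n. iterated_mean n h x) y sequentially"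
proof (rule sequentially_complete)
  fix q :: "'a \<Rightarrow> real" and e :: real assume q: "q \<in> P" and e: "0 < e"
  obtain F d where F: "finite F" "F \<subseteq> P" "0 < d"
    "\<And>x t. \<lbrakk>\<And>f. f \<in> F \<Longrightarrow> f x < d; 0 \<le> t; t \<le> 1\<rbrakk> \<Longrightarrow> q (T t x) \<le> e"
    using equicontinuous_unit_interval[OF q e] by metis
  have "\<forall>\<^sub>F s in at_right 0. \<forall>f\<in>F. \<forall>r\<in>{0..s}. f (T r x - x) \<le> d / 2"
    using F(2,3) by (intro eventually_ball_finite F(1) ballI T_strongly_cont_0) auto
  then obtain b where b: "0 < b" "\<And>s f r. \<lbrakk>0 < s; s < b; f \<in> F; 0 \<le> r; r \<le> s\<rbrakk> \<Longrightarrow> f (T r x - x) \<le> d / 2"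
    unfolding eventually_at_right_field by auto
  \<comment> \<open>Brings the tail scale h/2^n below b, where the orbit of x stays close to x in
    the seminorms of \<open>F\<close>.\<close>
  obtain n :: nat where n: "h / b < 2 ^ n"
    using real_arch_pow[of 2] by auto
  define s where "s = h / 2 ^ n"
  have s: "0 < s" "s < b" using n h b(1) by (auto simp: s_def field_simps)
  have s1: "s \<le> 1" using h order_trans[OF h(2)] by (simp add: s_def)
  have "q (iterated_mean (n + k) h x - iterated_mean n h x) \<le> e" for k
  proof -
    let ?z = "iterated_mean k s x"
    have "f (?z - x) < d" if f: "f \<in> F" for f
    proof -
      have "f (?z - x) \<le> d / 2"
        using subsetD[OF F(2) f] s(1) s1 b(2)[OF s f] by (rule iterated_mean_bound)
      then show ?thesis using F(3) by simp
    qed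
    then have "q (T r (?z - x) - 0) \<le> e" if "0 \<le> r" "r \<le> h" for r
      using F(4)[of "?z - x" r] that h(2) by simp
    \<comment> \<open>Averaging preserves the ball around v = 0 that contains the orbit of z -
      x.\<close>
    then have "q (iterated_mean n h (?z - x) - 0) \<le> e"
      by (rule iterated_mean_bound[OF q h])
    then show ?thesis
      by (simp add: iterated_mean_diff h(1) iterated_mean_add s_def)
  qed
  then show "\<exists>n. \<forall>k. q (iterated_mean (n + k) h x - iterated_mean n h x) \<le> e" by blast
qed

text \<open>Since \<open>quot\<close> commutes with \<open>R\<close>, one mean adds one power of
  \<open>R\<close>. The induction must range over all h because peeling off the outermost mean
  halves the scale.\<close>

lemma iterated_mean_limit_smooth:
  assumes "0 < h" "h \<le> 1" "limitin \<tau>\<^sub>0 (\<lambda>n. iterated_mean n h x) y sequentially"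
  shows "y \<in> range (R ^^ k)"
  using assms
proof (induction k arbitrary: h y)
  case 0
  then show ?case by simp
next
  case (Suc k)
  obtain z where z: "limitin \<tau>\<^sub>0 (\<lambda>n. iterated_mean n (h / 2) x) z sequentially"
    using iterated_mean_limit[of "h / 2" x] Suc.prems by auto
  have Rz: "limitin \<tau>\<^sub>0 (R \<circ> (\<lambda>n. iterated_mean n (h / 2) x)) (R z) sequentially"
    by (rule continuous_map_limit[OF R_cont z])
  have "limitin \<tau>\<^sub>0 (T (h / 2) \<circ> (R \<circ> (\<lambda>n. iterated_mean n (h / 2) x))) (T (h / 2) (R z)) sequentially"
    by (rule continuous_map_limit[OF T_cont Rz]) (use Suc.prems in simp)
  from limitin_scale[OF limitin_diff[OF this Rz], of "of_real (1 / (h / 2))"]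
  have "limitin \<tau>\<^sub>0 (\<lambda>n. iterated_mean (Suc n) h x) (quot (h / 2) (R z)) sequentially"
    by (simp add: quot_def o_def)
  moreover have "limitin \<tau>\<^sub>0 (\<lambda>n. iterated_mean (Suc n) h x) y sequentially"
    using limitin_sequentially_offset[OF Suc.prems(3), of 1] by simp
  ultimately have y: "y = quot (h / 2) (R z)"
    by (metis limitin_unique trivial_limit_sequentially)
  obtain w where w: "z = (R ^^ k) w"
    using Suc.IH[OF _ _ z] Suc.prems by auto
  have "y = (R ^^ Suc k) (quot (h / 2) w)"
    using Suc.prems(1) by (simp add: y w R_quot Rn_quot)
  then show ?case by blast
qed

lemma dense:
  assumes F: "finite F" "F \<subseteq> P" and e: "0 < e"
  obtains y where "y \<in> (\<Inter>k. range (R ^^ k))" "\<And>f. f \<in> F \<Longrightarrow> f (y - x) < e"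
proof -
  have "\<forall>\<^sub>F s in at_right 0. \<forall>f\<in>F. \<forall>r\<in>{0..s}. f (T r x - x) \<le> e / 3"
    using F(2) e by (intro eventually_ball_finite F(1) ballI T_strongly_cont_0) auto
  then obtain b where b: "0 < b"
      "\<And>s f r. \<lbrakk>0 < s; s < b; f \<in> F; 0 \<le> r; r \<le> s\<rbrakk> \<Longrightarrow> f (T r x - x) \<le> e / 3"
    unfolding eventually_at_right_field by auto
  \<comment> \<open>The halving keeps h strictly below b; the bound 1 is required by
    \<open>iterated_mean_limit\<close>.\<close>
  define h where "h = min 1 (b / 2)"
  have h: "0 < h" "h \<le> 1" "h < b" using b(1) by (auto simp: h_def)
  obtain y where y: "limitin \<tau>\<^sub>0 (\<lambda>n. iterated_mean n h x) y sequentially"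
    using iterated_mean_limit[OF h(1,2)] by blast
  have "f (y - x) < e" if f: "f \<in> F" for f
  proof -
    have fP: "f \<in> P" using f F(2) by blast
    have "(\<lambda>n. f (iterated_mean n h x - y)) \<longlonglongrightarrow> 0"
      using y fP unfolding limitin_iff by blast
    then have "\<forall>\<^sub>F n in sequentially. f (iterated_mean n h x - y) < e / 3"
      using e by (intro order_tendstoD(2)) auto
    then have "\<exists>n. f (iterated_mean n h x - y) < e / 3"
      by (rule eventually_happens'[OF sequentially_bot])
    then obtain n where n: "f (iterated_mean n h x - y) < e / 3" by (rule exE)
    let ?z = "iterated_mean n h x"
    have "f (?z - x) \<le> e / 3"
      using fP h(1,2) b(2)[OF h(1,3) f] by (rule iterated_mean_bound)
    moreover have "f (- (?z - y) + (?z - x)) \<le> f (- (?z - y)) + f (?z - x)"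
      by (rule seminorm_triangle[OF fP]) simp_all
    moreover have "- (?z - y) + (?z - x) = y - x" by simp
    ultimately show ?thesis
      using n seminorm_minus[OF fP, of "?z - y"] e by simp
  qed
  moreover have "y \<in> (\<Inter>k. range (R ^^ k))"
    using iterated_mean_limit_smooth[OF h(1,2) y] by blast
  ultimately show ?thesis by (intro that)
qed

end

subsection \<open>The spaces of the tower\<close>

context invertible_generator
begin

text \<open>
  The index set \<open>{n}\<close> gives the space \<open>X\<^sub>n\<close> of the tower and \<open>UNIV\<close> the universal interpolation space.
\<close>

definition carrier :: "nat set \<Rightarrow> 'a set" where
  "carrier N = (\<Inter>n\<in>N. range (R ^^ n))"

text \<open>With these, \<open>level N\<close> is the initial topology on \<open>carrier N\<close>
  for the maps \<open>A ^^ n\<close>, n in N, into level 0.\<close>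

definition seminorms :: "nat set \<Rightarrow> ('a \<Rightarrow> real) set" where
  "seminorms N = (\<Union>n\<in>N. (\<lambda>q. q \<circ> (A ^^ n)) ` P)"

definition level :: "nat set \<Rightarrow> 'a topology" where
  "level N = seminorm_topology (carrier N) (seminorms N)"

lemma topspace_level [simp]: "topspace (level N) = carrier N"
  by (simp add: level_def)

lemma carrierD: "x \<in> carrier N \<Longrightarrow> n \<in> N \<Longrightarrow> x \<in> range (R ^^ n)"
  unfolding carrier_def by (rule INT_D)

lemma carrierI: "(\<And>n. n \<in> N \<Longrightarrow> x \<in> range (R ^^ n)) \<Longrightarrow> x \<in> carrier N"
  unfolding carrier_def by (rule INT_I)

lemma carrier_singleton [simp]: "carrier {n} = range (R ^^ n)"
  by (simp add: carrier_def)

sublocale level: seminormed_space smul "carrier N" "seminorms N" for N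
proof
  show "subspace (carrier N)"
    unfolding carrier_def by (intro subspace_Inter) (auto simp: subspace_range_Rn)
  fix q assume "q \<in> seminorms N"
  then obtain n r where q: "n \<in> N" "r \<in> P" "q = r \<circ> (A ^^ n)"
    by (auto simp: seminorms_def)
  show "seminorm_on smul (carrier N) q"
    unfolding seminorm_on_def
  proof (intro conjI ballI allI)
    fix x y assume "x \<in> carrier N" "y \<in> carrier N"
    then show "q (x + y) \<le> q x + q y"
      using seminorm_triangle[OF q(2)] q carrierD by (simp add: An_add)
  next
    fix c x assume "x \<in> carrier N"
    then show "q (c \<cdot> x) = norm c * q x"
      using seminorm_scale[OF q(2)] q carrierD by (simp add: An_scale)
  qed
qed

lemma limitin_level:
  "limitin (level N) f l F \<longleftrightarrow> l \<in> carrier N \<and> (\<forall>\<^sub>F i in F. f i \<in> carrier N) \<and>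
     (\<forall>n\<in>N. limitin \<tau>\<^sub>0 (\<lambda>i. (A ^^ n) (f i)) ((A ^^ n) l) F)"
\<comment> \<open>Both sides contain this condition. Under it \<open>A ^^ n\<close> may be
  distributed over f i - l, which is legitimate only on the carrier.\<close>
proof (cases "l \<in> carrier N \<and> (\<forall>\<^sub>F i in F. f i \<in> carrier N)")
  case True
  have "((\<lambda>i. (q \<circ> (A ^^ n)) (f i - l)) \<longlongrightarrow> 0) F \<longleftrightarrow>
      ((\<lambda>i. q ((A ^^ n) (f i) - (A ^^ n) l)) \<longlongrightarrow> 0) F"
    if "n \<in> N" for q :: "'a \<Rightarrow> real" and n
  proof (rule tendsto_cong)
    show "\<forall>\<^sub>F i in F. (q \<circ> (A ^^ n)) (f i - l) = q ((A ^^ n) (f i) - (A ^^ n) l)"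
      using conjunct2[OF True]
    proof (rule eventually_mono)
      fix i assume "f i \<in> carrier N"
      then show "(q \<circ> (A ^^ n)) (f i - l) = q ((A ^^ n) (f i) - (A ^^ n) l)"
        using An_diff[OF carrierD[OF _ that] carrierD[OF _ that], of "f i" l] True by simp
    qed
  qed
  then show ?thesis
    unfolding level_def level.limitin_iff limitin_iff using True by (simp add: seminorms_def)
next
  case False
  then show ?thesis
    unfolding level_def level.limitin_iff by blast
qed

text \<open>The universal property of an initial topology, obtained pointwise from
  \<open>limitin_level\<close>.\<close>

lemma continuous_map_into_level:
  assumes "g \<in> topspace Z \<rightarrow> carrier N"
    and "\<And>n. n \<in> N \<Longrightarrow> continuous_map Z \<tau>\<^sub>0 (\<lambda>z. (A ^^ n) (g z))"
  shows "continuous_map Z (level N) g"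
  unfolding continuous_map_atin limitin_level
proof (intro ballI conjI)
  fix z assume z: "z \<in> topspace Z"
  show "g z \<in> carrier N" using assms(1) z by blast
  have "\<forall>x\<in>topspace Z - {z}. g x \<in> carrier N" using assms(1) by blast
  then show "\<forall>\<^sub>F x in atin Z z. g x \<in> carrier N"
    unfolding eventually_atin using z openin_topspace by blast
  fix n assume "n \<in> N"
  then show "limitin \<tau>\<^sub>0 (\<lambda>z. (A ^^ n) (g z)) ((A ^^ n) (g z)) (atin Z z)"
    using assms(2) z unfolding continuous_map_atin by (rule_tac bspec) auto
qed

lemma continuous_map_An:
  assumes "n \<in> N"
  shows "continuous_map (level N) \<tau>\<^sub>0 (A ^^ n)"
  unfolding continuous_map_atin
proof
  fix x assume x: "x \<in> topspace (level N)"
  have "continuous_map (level N) (level N) (\<lambda>x. x)" by simp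
  then have "limitin (level N) (\<lambda>x. x) x (atin (level N) x)"
    unfolding continuous_map_atin using x by (rule bspec)
  then show "limitin \<tau>\<^sub>0 (A ^^ n) ((A ^^ n) x) (atin (level N) x)"
    unfolding limitin_level using assms by simp
qed

section \<open>Transfer of operators and of the semigroup from level 0\<close>

lemma continuous_operators_level:
  assumes f: "f \<in> continuous_operators smul \<tau>\<^sub>0"
    and range: "\<And>n x. n \<in> N \<Longrightarrow> x \<in> range (R ^^ n) \<Longrightarrow> f x \<in> range (R ^^ n)"
    and comm: "\<And>n x. n \<in> N \<Longrightarrow> x \<in> range (R ^^ n) \<Longrightarrow> (A ^^ n) (f x) = f ((A ^^ n) x)"
  shows "f \<in> continuous_operators smul (level N)"
proof -
  have lin: "linear_on_carrier smul UNIV f" and cont: "continuous_map \<tau>\<^sub>0 \<tau>\<^sub>0 f"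
    using f by (simp_all add: continuous_operators_def)
  have "continuous_map (level N) (level N) f"
  proof (rule continuous_map_into_level)
    show "f \<in> topspace (level N) \<rightarrow> carrier N"
      using range carrierD by (auto intro!: carrierI)
    fix n assume n: "n \<in> N"
    show "continuous_map (level N) \<tau>\<^sub>0 (\<lambda>z. (A ^^ n) (f z))"
      by (rule continuous_map_eq[OF continuous_map_compose[OF continuous_map_An[OF n] cont]])
        (use comm n carrierD in simp)
  qed
  then show ?thesis
    using lin by (simp add: continuous_operators_def linear_on_carrier_def)
qed

text \<open>Because f commutes with \<open>A ^^ n\<close>, q ((A ^^ n) (f x)) = q (f ((A ^^ n) x)).
  A level-0 neighbourhood serving all of \<open>H\<close> is therefore pulled back along
  \<open>A ^^ n\<close>.\<close>

lemma equicontinuous_operators_level: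
  assumes H: "equicontinuous_operators smul \<tau>\<^sub>0 H"
    and range: "\<And>f n x. f \<in> H \<Longrightarrow> n \<in> N \<Longrightarrow> x \<in> range (R ^^ n) \<Longrightarrow> f x \<in> range (R ^^ n)"
    and comm: "\<And>f n x. f \<in> H \<Longrightarrow> n \<in> N \<Longrightarrow> x \<in> range (R ^^ n) \<Longrightarrow> (A ^^ n) (f x) = f ((A ^^ n) x)"
  shows "equicontinuous_operators smul (level N) H"
  unfolding equicontinuous_operators_def
proof (intro conjI allI impI)
  note eq = H[unfolded equicontinuous_operators_def]
  show "H \<subseteq> continuous_operators smul (level N)"
  proof
    fix g assume g: "g \<in> H"
    show "g \<in> continuous_operators smul (level N)"
      by (rule continuous_operators_level[OF subsetD[OF conjunct1[OF eq] g]])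
        (rule range[OF g] comm[OF g]; assumption)+
  qed
  fix V assume "openin (level N) V \<and> 0 \<in> V"
  then have "openin (seminorm_topology (carrier N) (seminorms N)) V" "0 \<in> V"
    unfolding level_def by blast+
  then obtain F e where F: "finite F" "F \<subseteq> seminorms N" "0 < e"
      "{y\<in>carrier N. \<forall>q\<in>F. q (y - 0) < e} \<subseteq> V"
    by (rule level.openin_ballE)
  \<comment> \<open>Each of the finitely many seminorms may come from a different n and gets its own
    neighbourhood; they are intersected afterwards.\<close>
  have "\<exists>U. openin (level N) U \<and> 0 \<in> U \<and> (\<forall>g\<in>H. \<forall>x\<in>U. f (g x) < e)" if fF: "f \<in> F" for f
  proof -
    obtain n q where f: "n \<in> N" "q \<in> P" "f = q \<circ> (A ^^ n)"
      using fF F(2) by (auto simp: seminorms_def)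
    let ?W = "{y\<in>UNIV. \<forall>r\<in>{q}. r (y - 0) < e}"
    have "openin \<tau>\<^sub>0 ?W \<and> 0 \<in> ?W"
      using openin_ball[of "{q}" 0 e] f(2) F(3) seminorm_zero[OF f(2)] by simp
    then have "\<exists>U. openin \<tau>\<^sub>0 U \<and> 0 \<in> U \<and> (\<forall>g\<in>H. g ` U \<subseteq> ?W)"
      by (rule mp[OF spec[OF conjunct2[OF eq]]])
    then obtain U where U: "openin \<tau>\<^sub>0 U" "0 \<in> U" "\<forall>g\<in>H. g ` U \<subseteq> ?W"
      by (elim exE conjE)
    have "openin (level N) {x \<in> topspace (level N). (A ^^ n) x \<in> U}"
      by (rule openin_continuous_map_preimage[OF continuous_map_An[OF f(1)] U(1)])
    moreover have "0 \<in> carrier N" by (rule subspace_0[OF level.subspace])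
    moreover have "f (g x) < e" if g: "g \<in> H" and x: "x \<in> carrier N" "(A ^^ n) x \<in> U" for g x
    proof -
      have "g ((A ^^ n) x) \<in> ?W"
        by (rule subsetD[OF bspec[OF U(3) g]]) (rule imageI, rule x(2))
      then show ?thesis
        using comm[OF g f(1) carrierD[OF x(1) f(1)]] f(3) by simp
    qed
    ultimately show ?thesis
      using U(2) An_zero by (intro exI[of _ "{x \<in> topspace (level N). (A ^^ n) x \<in> U}"]) simp
  qed
  then obtain U where U: "\<And>f. f \<in> F \<Longrightarrow> openin (level N) (U f)" "\<And>f. f \<in> F \<Longrightarrow> 0 \<in> U f"
      "\<And>f g x. f \<in> F \<Longrightarrow> g \<in> H \<Longrightarrow> x \<in> U f \<Longrightarrow> f (g x) < e"
    by metis
  let ?U = "topspace (level N) \<inter> (\<Inter>f\<in>F. U f)"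
  have "openin (level N) ?U"
    using F(1) U(1)
    by (cases "F = {}")
      (simp_all only: openin_topspace openin_Int openin_INT2 image_empty Inter_empty Int_UNIV_right
        simp_thms)
  moreover have "0 \<in> ?U"
    using U(2) subspace_0[OF level.subspace] by simp
  moreover have "g ` ?U \<subseteq> V" if g: "g \<in> H" for g
  proof (rule image_subsetI)
    fix x assume x: "x \<in> ?U"
    have "g x \<in> carrier N"
      using x by (intro carrierI range[OF g _]) (auto dest: carrierD)
    moreover have "\<forall>f\<in>F. f (g x - 0) < e"
      using x U(3)[OF _ g] by simp
    ultimately show "g x \<in> V" using F(4) by blast
  qed
  ultimately show "\<exists>U. openin (level N) U \<and> 0 \<in> U \<and> (\<forall>f\<in>H. f ` U \<subseteq> V)" by blast
qed

lemma semigroup_level: "sc_exp_equicontinuous_semigroup smul (level N) T"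
  unfolding sc_exp_equicontinuous_semigroup_def topspace_level
proof (intro conjI allI ballI impI)
  show "T t \<in> continuous_operators smul (level N)" if "0 \<le> t" for t
  proof (rule continuous_operators_level)
    show "T t \<in> continuous_operators smul \<tau>\<^sub>0"
      using that by (simp add: continuous_operators_def linear_on_carrier_def T_add T_scale T_cont)
  qed (simp_all only: T_range_Rn An_T that)
  show "T (t + s) x = T t (T s x)" if "0 \<le> t" "0 \<le> s" for t s x
    using that by (rule T_plus)
  show "T 0 x = x" for x by (rule T_zero)
  show "continuous_map (top_of_set {0..}) (level N) (\<lambda>t. T t x)" if x: "x \<in> carrier N" for x
  proof (rule continuous_map_into_level)
    show "(\<lambda>t. T t x) \<in> topspace (top_of_set {0..}) \<rightarrow> carrier N"
      using x by (auto intro!: carrierI T_range_Rn dest: carrierD)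
    fix n assume "n \<in> N"
    then show "continuous_map (top_of_set {0..}) \<tau>\<^sub>0 (\<lambda>t. (A ^^ n) (T t x))"
      using carrierD[OF x] by (intro continuous_map_eq[OF T_strongly_cont]) (simp add: An_T)
  qed
  obtain \<omega> where \<omega>: "equicontinuous_operators smul \<tau>\<^sub>0 {\<lambda>x. of_real (exp (\<omega> * t)) \<cdot> T t x |t. 0 \<le> t}"
    by (rule equicontinuous)
  have "equicontinuous_operators smul (level N) {\<lambda>x. of_real (exp (\<omega> * t)) \<cdot> T t x |t. 0 \<le> t}"
    by (rule equicontinuous_operators_level[OF \<omega>])
      (elim CollectE exE conjE, simp only: scale_range_Rn T_range_Rn An_scale An_T)+
  then show "\<exists>\<omega>. equicontinuous_operators smul (level N)
      {\<lambda>x. of_real (exp (\<omega> * t)) \<cdot> T t x |t. 0 \<le> t}" by (rule exI)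
qed

section \<open>Generators of the semigroup on the levels\<close>

lemma A_range_Rn: "x \<in> range (R ^^ Suc n) \<Longrightarrow> A x \<in> range (R ^^ n)"
  by auto

text \<open>Determines domain and generator together: applying \<open>A ^^ n\<close> gives the
  difference quotient of \<open>(A ^^ n) x\<close> at level 0, whose convergence means
  \<open>(A ^^ n) x \<in> D\<close>. An index in \<open>N\<close> is what pins down y.\<close>

lemma limitin_level_quot:
  assumes "N \<noteq> {}" and x: "x \<in> carrier N"
  shows "limitin (level N) (\<lambda>t. quot t x) y (at_right 0) \<longleftrightarrow>
    (\<forall>n\<in>N. x \<in> range (R ^^ Suc n)) \<and> y = A x"
proof (intro iffI conjI)
  assume L: "limitin (level N) (\<lambda>t. quot t x) y (at_right 0)"
  then have y: "y \<in> carrier N" by (simp add: limitin_level)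
  have gen: "(A ^^ n) x \<in> D \<and> A ((A ^^ n) x) = (A ^^ n) y" if n: "n \<in> N" for n
  proof -
    have "limitin \<tau>\<^sub>0 (\<lambda>t. (A ^^ n) (quot t x)) ((A ^^ n) y) (at_right 0)"
      using L n unfolding limitin_level by blast
    then have "limitin \<tau>\<^sub>0 (\<lambda>t. quot t ((A ^^ n) x)) ((A ^^ n) y) (at_right 0)"
      by (rule limitin_cong_right) (rule An_quot[OF carrierD[OF x n]])
    from generatorI[OF this] show ?thesis by blast
  qed
  show range: "\<forall>n\<in>N. x \<in> range (R ^^ Suc n)"
    using gen carrierD[OF x] by (simp only: range_Rn_Suc) blast
  obtain n where n: "n \<in> N" using assms(1) by blast
  have "(A ^^ n) y = (A ^^ n) (A x)"
    using gen[OF n] by (simp add: funpow_swap1)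
  \<comment> \<open>Both y and \<open>A x\<close> lie in \<open>range (R ^^ n)\<close>, where
    \<open>A ^^ n\<close> is injective with inverse \<open>R ^^ n\<close>.\<close>
  then show "y = A x"
    using Rn_An[OF carrierD[OF y n]] Rn_An[OF A_range_Rn[OF bspec[OF range n]]] by metis
next
  assume R: "(\<forall>n\<in>N. x \<in> range (R ^^ Suc n)) \<and> y = A x"
  show "limitin (level N) (\<lambda>t. quot t x) y (at_right 0)"
    unfolding limitin_level
  proof (intro conjI ballI)
    show "y \<in> carrier N"
      unfolding conjunct2[OF R] using R by (intro carrierI A_range_Rn) blast
    show "\<forall>\<^sub>F t in at_right 0. quot t x \<in> carrier N"
      by (rule eventually_mono[OF eventually_at_right_0])
        (use x in \<open>auto intro!: carrierI quot_range_Rn dest: carrierD\<close>)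
    fix n assume n: "n \<in> N"
    have "(A ^^ n) x \<in> D" using R n range_Rn_Suc by blast
    then have "limitin \<tau>\<^sub>0 (\<lambda>t. quot t ((A ^^ n) x)) (A ((A ^^ n) x)) (at_right 0)"
      by (rule generator_limit)
    then have "limitin \<tau>\<^sub>0 (\<lambda>t. (A ^^ n) (quot t x)) (A ((A ^^ n) x)) (at_right 0)"
      by (rule limitin_cong_right) (rule An_quot[OF carrierD[OF x n], symmetric])
    then show "limitin \<tau>\<^sub>0 (\<lambda>t. (A ^^ n) (quot t x)) ((A ^^ n) y) (at_right 0)"
      using R by (simp add: funpow_swap1)
  qed
qed

lemma generator_domain_level:
  assumes "N \<noteq> {}"
  shows "generator_domain smul (level N) T = {x \<in> carrier N. \<forall>n\<in>N. x \<in> range (R ^^ Suc n)}"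
proof -
  have eq: "(\<exists>y. limitin (level N) (\<lambda>t. quot t x) y (at_right 0)) \<longleftrightarrow> (\<forall>n\<in>N. x \<in> range (R ^^ Suc n))"
    if "x \<in> carrier N" for x
    unfolding limitin_level_quot[OF assms that] by blast
  then show ?thesis
    unfolding generator_domain_def quot_def[symmetric] topspace_level
    by (intro Collect_cong conj_cong refl eq)
qed

lemma generator_level:
  assumes "N \<noteq> {}" "x \<in> generator_domain smul (level N) T"
  shows "generator smul (level N) T x = A x"
proof -
  have x: "x \<in> carrier N" "\<forall>n\<in>N. x \<in> range (R ^^ Suc n)"
    using assms(2) unfolding generator_domain_level[OF assms(1)] by simp_all
  show ?thesis
    unfolding generator_def quot_def[symmetric] limitin_level_quot[OF assms(1) x(1)]
    using x(2) by simp
qed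

lemma generator_domain_level_singleton:
  "generator_domain smul (level {n}) T = range (R ^^ Suc n)"
  using range_Rn_mono[of n "Suc n"] unfolding generator_domain_level[of "{n}", simplified] by auto

text \<open>The shift from n to n + 1 costs nothing when every n is present, so the limit generator
  is defined everywhere.\<close>

lemma generator_domain_level_UNIV: "generator_domain smul (level UNIV) T = carrier UNIV"
  unfolding generator_domain_level[OF UNIV_not_empty] by (auto simp del: funpow.simps dest: carrierD)

lemma A_carrier_UNIV: "x \<in> carrier UNIV \<Longrightarrow> A x \<in> carrier UNIV"
  by (rule carrierI, rule A_range_Rn) (rule carrierD, auto)

lemma R_carrier_UNIV:
  assumes "x \<in> carrier UNIV"
  shows "R x \<in> carrier UNIV"
proof (rule carrierI)
  fix n
  obtain y where "x = (R ^^ n) y" using carrierD[OF assms UNIV_I] by blast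
  then have "R x = (R ^^ n) (R y)" by (simp add: funpow_swap1)
  then show "R x \<in> range (R ^^ n)" by blast
qed

lemma Rn_carrier_UNIV: "x \<in> carrier UNIV \<Longrightarrow> (R ^^ n) x \<in> carrier UNIV"
  by (induction n) (simp_all add: R_carrier_UNIV)

lemma carrier_UNIV_D: "x \<in> carrier UNIV \<Longrightarrow> x \<in> D"
  using carrierD[of x UNIV 1] range_R by auto

text \<open>In the seminorms q o A^n, composing with \<open>A\<close> raises the index by one and
  composing with \<open>R\<close> lowers it by one; all indices are available.\<close>

lemma homeomorphic_maps_A: "homeomorphic_maps (level UNIV) (level UNIV) A R"
  unfolding homeomorphic_maps_def topspace_level
proof (intro conjI ballI)
  show "continuous_map (level UNIV) (level UNIV) A"
  proof (rule continuous_map_into_level)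
    show "A \<in> topspace (level UNIV) \<rightarrow> carrier UNIV" using A_carrier_UNIV by auto
    show "continuous_map (level UNIV) \<tau>\<^sub>0 (\<lambda>z. (A ^^ n) (A z))" for n
      using continuous_map_An[of "Suc n" UNIV] by (simp add: funpow_Suc_right o_def del: funpow.simps)
  qed
  show "continuous_map (level UNIV) (level UNIV) R"
  proof (rule continuous_map_into_level)
    show "R \<in> topspace (level UNIV) \<rightarrow> carrier UNIV" using R_carrier_UNIV by auto
    show "continuous_map (level UNIV) \<tau>\<^sub>0 (\<lambda>z. (A ^^ n) (R z))" for n
    \<comment> \<open>At n = 0 no power of \<open>A\<close> absorbs \<open>R\<close>, and continuity
      of \<open>R\<close> at level 0 is used instead.\<close>
    proof (cases n)
      case 0
      then show ?thesis
        using continuous_map_compose[OF continuous_map_An[of 0 UNIV] R_cont] by (simp add: o_def)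
    next
      case (Suc m)
      then show ?thesis
        using continuous_map_An[of m UNIV] by (simp add: funpow_Suc_right o_def del: funpow.simps)
    qed
  qed
  show "R (A x) = x" if "x \<in> carrier UNIV" for x
    using that by (rule R_A[OF carrier_UNIV_D])
qed simp

text \<open>\<open>R ^^ n\<close> carries density from level 0 to level n: approximate
  \<open>(A ^^ n) x\<close> by y in the intersection, then take \<open>(R ^^ n) y\<close>, which
  stays in the intersection.\<close>

lemma dense_level: "level {n} closure_of carrier UNIV = range (R ^^ n)"
proof
  show "level {n} closure_of carrier UNIV \<subseteq> range (R ^^ n)"
    using closure_of_subset_topspace[of "level {n}"] by simp
  show "range (R ^^ n) \<subseteq> level {n} closure_of carrier UNIV"
  proof
    fix x assume x: "x \<in> range (R ^^ n)"
    have "\<exists>y. y \<in> carrier UNIV \<and> y \<in> U" if U: "openin (level {n}) U" "x \<in> U" for U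
    proof -
      obtain F e where F: "finite F" "F \<subseteq> seminorms {n}" "0 < e"
          "{y\<in>carrier {n}. \<forall>q\<in>F. q (y - x) < e} \<subseteq> U"
        by (rule level.openin_ballE[OF U[unfolded level_def]])
      have "F \<subseteq> (\<lambda>q. q \<circ> (A ^^ n)) ` P" using F(2) by (simp add: seminorms_def)
      from finite_subset_image[OF F(1) this] obtain G where
        G: "G \<subseteq> P" "finite G" "F = (\<lambda>q. q \<circ> (A ^^ n)) ` G"
        by blast
      obtain y where y: "y \<in> (\<Inter>k. range (R ^^ k))" "\<And>f. f \<in> G \<Longrightarrow> f (y - (A ^^ n) x) < e"
        using dense[OF G(2,1) F(3)] by metis
      have "(R ^^ n) y \<in> carrier UNIV"
        using y(1) by (intro Rn_carrier_UNIV) (simp add: carrier_def)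
      moreover have "\<forall>q\<in>F. q ((R ^^ n) y - x) < e"
        using y(2) by (simp add: G(3) An_diff x)
      then have "(R ^^ n) y \<in> U" using F(4) by auto
      ultimately show ?thesis by blast
    qed
    then show "x \<in> level {n} closure_of carrier UNIV"
      unfolding in_closure_of using x by simp
  qed
qed

text \<open>Along a Cauchy filter every \<open>A ^^ n\<close> converges at level 0, to
  \<open>l n\<close>. Continuity of \<open>R\<close> links these limits, and \<open>l 0\<close> is
  the limit sought.\<close>

lemma complete_level_UNIV: "complete_locally_convex smul (level UNIV)"
  unfolding complete_locally_convex_def
proof (intro conjI allI impI)
  show "locally_convex smul (level UNIV)"
    unfolding level_def by (rule level.locally_convex)
  fix F assume F: "cauchy_filter_in (level UNIV) F"
  then have bot: "F \<noteq> bot" and S: "\<forall>\<^sub>F x in F. x \<in> carrier UNIV"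
    and V: "\<And>V. openin (level UNIV) V \<Longrightarrow> 0 \<in> V \<Longrightarrow> \<forall>\<^sub>F (x, y) in F \<times>\<^sub>F F. x - y \<in> V"
    unfolding cauchy_filter_in_def by simp_all
  have S2: "\<forall>\<^sub>F z in F \<times>\<^sub>F F. fst z \<in> carrier UNIV \<and> snd z \<in> carrier UNIV"
    unfolding eventually_prod_same using S by (intro exI[of _ "\<lambda>x. x \<in> carrier UNIV"]) simp
  have "\<exists>l. limitin \<tau>\<^sub>0 (A ^^ n) l F" for n
  proof -
    have "cauchy_filter_in \<tau>\<^sub>0 (filtermap (A ^^ n) F)"
      unfolding cauchy_filter_in_def
    proof (intro conjI allI impI)
      fix W assume W: "openin \<tau>\<^sub>0 W \<and> 0 \<in> W"
      let ?V = "{x \<in> topspace (level UNIV). (A ^^ n) x \<in> W}"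
      have "0 \<in> carrier UNIV" by (rule subspace_0[OF level.subspace])
      then have "0 \<in> ?V" using W by (simp add: An_zero)
      moreover have "openin (level UNIV) ?V"
        using W by (intro openin_continuous_map_preimage[OF continuous_map_An]) auto
      ultimately have "\<forall>\<^sub>F (x, y) in F \<times>\<^sub>F F. x - y \<in> ?V" by (intro V)
      with S2 have "\<forall>\<^sub>F z in F \<times>\<^sub>F F. (A ^^ n) (fst z) - (A ^^ n) (snd z) \<in> W"
      proof eventually_elim
        case (elim z)
        then have "(A ^^ n) (fst z - snd z) \<in> W" by (simp add: case_prod_unfold)
        then show ?case
          using elim(1) An_diff[OF carrierD[OF _ UNIV_I] carrierD[OF _ UNIV_I]] by simp
      qed
      then show "\<forall>\<^sub>F (x, y) in filtermap (A ^^ n) F \<times>\<^sub>F filtermap (A ^^ n) F. x - y \<in> W"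
        by (simp add: prod_filtermap1 prod_filtermap2 eventually_filtermap case_prod_unfold)
    qed (simp_all add: filtermap_bot_iff bot)
    then obtain l where "limitin \<tau>\<^sub>0 (\<lambda>y. y) l (filtermap (A ^^ n) F)"
      using complete unfolding complete_locally_convex_def by blast
    then show ?thesis
      unfolding limitin_def eventually_filtermap by blast
  qed
  then obtain l where l: "\<And>n. limitin \<tau>\<^sub>0 (A ^^ n) (l n) F" by metis
  \<comment> \<open>This coherence gives \<open>l 0 = (R ^^ n) (l n)\<close>: \<open>l 0\<close>
    belongs to every range, and \<open>A ^^ n\<close> maps it to \<open>l n\<close>.\<close>
  have R_l: "R (l (Suc n)) = l n" for n
  proof (rule limitin_unique)
    have "limitin \<tau>\<^sub>0 (R \<circ> (A ^^ Suc n)) (R (l (Suc n))) F"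
      by (rule continuous_map_limit[OF R_cont l])
    then show "limitin \<tau>\<^sub>0 (A ^^ n) (R (l (Suc n))) F"
    proof (rule limitin_transform_eventually[rotated])
      show "\<forall>\<^sub>F x in F. (R \<circ> (A ^^ Suc n)) x = (A ^^ n) x"
        using S
      proof (rule eventually_mono)
        fix x assume "x \<in> carrier UNIV"
        then have "x \<in> range (R ^^ Suc n)" by (rule carrierD) simp
        then have "(A ^^ n) x \<in> D" using range_Rn_Suc by blast
        then show "(R \<circ> (A ^^ Suc n)) x = (A ^^ n) x" by (simp add: R_A)
      qed
    qed
  qed (rule l bot)+
  have l0: "l 0 = (R ^^ n) (l n)" for n
    by (induction n) (simp_all add: funpow_swap1 R_l)
  have "l 0 \<in> carrier UNIV"
    by (rule carrierI) (use l0 in blast)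
  moreover have "(A ^^ n) (l 0) = l n" for n
    using l0[of n] by simp
  ultimately have "limitin (level UNIV) (\<lambda>y. y) (l 0) F"
    unfolding limitin_level using S l by simp
  then show "\<exists>x. limitin (level UNIV) (\<lambda>y. y) x F" by blast
qed

text \<open>Carriers and seminorms need a joint induction, since the next carrier is a generator
  domain for the topology that both determine. The seminorm formula is claimed only on the carrier,
  where \<open>generator\<close> is known to equal \<open>A\<close>.\<close>

lemma sobolev_tower_level:
  assumes P: "P = p ` \<Gamma>"
  shows "sobolev_space smul \<Gamma> p T n = range (R ^^ n)"
    and "sobolev_topology smul \<Gamma> p T n = level {n}"
proof -
  let ?q = "\<lambda>n. snd (sobolev_tower smul \<Gamma> p T n)"
  have top: "sobolev_topology smul \<Gamma> p T n = level {n}"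
    if X: "sobolev_space smul \<Gamma> p T n = range (R ^^ n)"
      and q: "\<forall>\<gamma>. \<forall>x\<in>range (R ^^ n). ?q n \<gamma> x = p \<gamma> ((A ^^ n) x)" for n
    unfolding sobolev_topology_def level_def X carrier_singleton
  proof (rule seminorm_topology_cong)
    show "x - y \<in> range (R ^^ n)" if "x \<in> range (R ^^ n)" "y \<in> range (R ^^ n)" for x y
      using that by (rule diff_range_Rn)
    show "\<exists>q'\<in>seminorms {n}. \<forall>x\<in>range (R ^^ n). r x = q' x" if r: "r \<in> ?q n ` \<Gamma>" for r
    proof -
      obtain \<gamma> where \<gamma>: "\<gamma> \<in> \<Gamma>" "r = ?q n \<gamma>" using r by blast
      then have "p \<gamma> \<in> P" using P by blast
      then have "p \<gamma> \<circ> (A ^^ n) \<in> seminorms {n}" by (auto simp: seminorms_def)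
      then show ?thesis
        by (rule bexI[rotated]) (use q \<gamma>(2) in simp)
    qed
    show "\<exists>q\<in>?q n ` \<Gamma>. \<forall>x\<in>range (R ^^ n). q x = q' x" if q': "q' \<in> seminorms {n}" for q'
    proof -
      obtain r where r: "r \<in> P" "q' = r \<circ> (A ^^ n)" using q' by (auto simp: seminorms_def)
      obtain \<gamma> where \<gamma>: "\<gamma> \<in> \<Gamma>" "r = p \<gamma>" using r(1) P by blast
      show ?thesis
        by (rule bexI[of _ "?q n \<gamma>"]) (use q \<gamma> r(2) in simp_all)
    qed
  qed
  have tower: "sobolev_space smul \<Gamma> p T n = range (R ^^ n) \<and>
      (\<forall>\<gamma>. \<forall>x\<in>range (R ^^ n). ?q n \<gamma> x = p \<gamma> ((A ^^ n) x))" for n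
  proof (induction n)
    case 0
    then show ?case by (simp add: sobolev_space_0)
  next
    case (Suc n)
    have t: "sobolev_topology smul \<Gamma> p T n = level {n}"
      using Suc top by blast
    have "sobolev_space smul \<Gamma> p T (Suc n) = range (R ^^ Suc n)"
      unfolding sobolev_space_Suc t by (rule generator_domain_level_singleton)
    moreover have "?q (Suc n) \<gamma> x = p \<gamma> ((A ^^ Suc n) x)" if x: "x \<in> range (R ^^ Suc n)" for \<gamma> x
    proof -
      have "?q (Suc n) \<gamma> x = ?q n \<gamma> (generator smul (sobolev_topology smul \<Gamma> p T n) T x)"
        by (simp add: sobolev_topology_def sobolev_space_def Let_def case_prod_unfold)
      also have "generator smul (sobolev_topology smul \<Gamma> p T n) T x = A x"
        unfolding t by (rule generator_level) (use x generator_domain_level_singleton in auto)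
      also have "?q n \<gamma> (A x) = p \<gamma> ((A ^^ n) (A x))"
        using Suc A_range_Rn[OF x] by blast
      finally show ?thesis by (simp add: funpow_swap1)
    qed
    ultimately show ?case by blast
  qed
  show "sobolev_space smul \<Gamma> p T n = range (R ^^ n)" using tower by blast
  show "sobolev_topology smul \<Gamma> p T n = level {n}" using tower top by blast
qed

text \<open>The seminorms of all levels together are \<open>seminorms UNIV\<close>, so the
  projective limit is again a space \<open>level N\<close> and the transfer results apply to
  it.\<close>

lemma projective_topology_level:
  "projective_topology smul (carrier UNIV) (\<lambda>n. level {n}) = level UNIV"
proof -
  have "projective_topology smul (\<Inter>n. carrier {n})
      (\<lambda>n. seminorm_topology (carrier {n}) (seminorms {n}))
      = seminorm_topology (\<Inter>n. carrier {n}) (\<Union>n. seminorms {n})"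
    by (rule projective_topology_eq(2)[OF vector_space_axioms level.subspace level.seminorm])
  moreover have "(\<Inter>n. carrier {n}) = carrier UNIV" "(\<Union>n. seminorms {n}) = seminorms UNIV"
    by (simp_all add: carrier_def seminorms_def)
  ultimately show ?thesis by (simp only: level_def)
qed

end

theorem theorem5p1:
  fixes smul :: "'k::real_normed_field \<Rightarrow> 'a::ab_group_add \<Rightarrow> 'a"
    and \<Gamma> :: "'i set" and p :: "'i \<Rightarrow> 'a \<Rightarrow> real" and T :: "real \<Rightarrow> 'a \<Rightarrow> 'a"
    and X :: "nat \<Rightarrow> 'a set" and \<tau> :: "nat \<Rightarrow> 'a topology" and A :: "nat \<Rightarrow> 'a \<Rightarrow> 'a"
    and Xinf :: "'a set" and \<tau>inf :: "'a topology"
  defines "X \<equiv> sobolev_space smul \<Gamma> p T"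
    and "\<tau> \<equiv> sobolev_topology smul \<Gamma> p T"
    and "A \<equiv> \<lambda>n. generator smul (\<tau> n) T"
    and "Xinf \<equiv> (\<Inter>n. X n)"
    and "\<tau>inf \<equiv> projective_topology smul Xinf \<tau>"
  assumes "vector_space smul"
    and "\<And>\<gamma>. \<gamma> \<in> \<Gamma> \<Longrightarrow> seminorm_on smul UNIV (p \<gamma>)"
    and "Hausdorff_space (\<tau> 0)"
    and "complete_locally_convex smul (\<tau> 0)"
    and "sc_exp_equicontinuous_semigroup smul (\<tau> 0) T"
    and "bij_betw (A 0) (generator_domain smul (\<tau> 0) T) UNIV"
    and "continuous_map (\<tau> 0) (\<tau> 0) (inv_into (generator_domain smul (\<tau> 0) T) (A 0))"
  shows "(\<forall>n. \<tau> n closure_of Xinf = X n) \<and>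
         topspace \<tau>inf = Xinf \<and> complete_locally_convex smul \<tau>inf \<and>
         sc_exp_equicontinuous_semigroup smul \<tau>inf T \<and>
         generator_domain smul \<tau>inf T = Xinf \<and>
         (\<forall>x\<in>Xinf. generator smul \<tau>inf T x = A 0 x) \<and>
         linear_on_carrier smul Xinf (A 0) \<and> homeomorphic_map \<tau>inf \<tau>inf (A 0) \<and>
         (\<forall>n. \<forall>x\<in>Xinf. inv_into Xinf (A 0) x = inv_into (generator_domain smul (\<tau> n) T) (A n) x)"
proof -
  have \<tau>0: "\<tau> 0 = seminorm_topology UNIV (p ` \<Gamma>)"
    unfolding \<tau>_def by (rule sobolev_topology_0)
  interpret vector_space smul by fact
  interpret G: invertible_generator smul "p ` \<Gamma>" T
  proof
    show "Hausdorff_space (seminorm_topology UNIV (p ` \<Gamma>))"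
      "complete_locally_convex smul (seminorm_topology UNIV (p ` \<Gamma>))"
      "sc_exp_equicontinuous_semigroup smul (seminorm_topology UNIV (p ` \<Gamma>)) T"
      using assms(8-10) unfolding \<tau>0 .
    show "bij_betw (generator smul (seminorm_topology UNIV (p ` \<Gamma>)) T)
        (generator_domain smul (seminorm_topology UNIV (p ` \<Gamma>)) T) UNIV"
      "continuous_map (seminorm_topology UNIV (p ` \<Gamma>)) (seminorm_topology UNIV (p ` \<Gamma>))
        (inv_into (generator_domain smul (seminorm_topology UNIV (p ` \<Gamma>)) T)
          (generator smul (seminorm_topology UNIV (p ` \<Gamma>)) T))"
      using assms(11,12) unfolding A_def \<tau>0 .
  qed (use assms(7) in auto)
  have X: "X n = range (G.R ^^ n)" and \<tau>: "\<tau> n = G.level {n}" for n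
    unfolding X_def \<tau>_def by (rule G.sobolev_tower_level[OF refl])+
  have Xinf: "Xinf = G.carrier UNIV"
    by (simp add: Xinf_def X G.carrier_def)
  have \<tau>inf: "\<tau>inf = G.level UNIV"
    unfolding \<tau>inf_def Xinf ext[of \<tau>, OF \<tau>] by (rule G.projective_topology_level)
  have A0: "A 0 = G.A"
    by (simp add: A_def G.A_def \<tau>0)
  \<comment> \<open>Equality with \<open>G.A\<close> is available on the domain of the n-th
    generator; only for n = 0 is it an equality of functions.\<close>
  have An: "A n x = G.A x" if "x \<in> range (G.R ^^ Suc n)" for n x
    unfolding A_def \<tau> by (rule G.generator_level) (use that G.generator_domain_level_singleton in auto)
  have inv_inf: "inv_into Xinf (A 0) x = G.R x" if x: "x \<in> Xinf" for x
    unfolding A0 Xinf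
  proof (rule inv_into_f_eq)
    show "inj_on G.A (G.carrier UNIV)"
      by (rule inj_on_inverseI[of _ G.R]) (rule G.R_A[OF G.carrier_UNIV_D])
    show "G.R x \<in> G.carrier UNIV" using x unfolding Xinf by (rule G.R_carrier_UNIV)
  qed simp
  \<comment> \<open>The domains differ with n, but \<open>G.R x\<close> lies in all of them when x
    is in the intersection, so every inverse takes the value \<open>G.R x\<close> there.\<close>
  have inv_n: "inv_into (generator_domain smul (\<tau> n) T) (A n) x = G.R x" if x: "x \<in> Xinf" for n x
    unfolding \<tau> G.generator_domain_level_singleton
  proof (rule inv_into_f_eq)
    show "inj_on (A n) (range (G.R ^^ Suc n))"
    proof (rule inj_on_inverseI[of _ G.R])
      fix y assume y: "y \<in> range (G.R ^^ Suc n)"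
      then have "y \<in> G.D" using G.range_R by auto
      then show "G.R (A n y) = y" by (simp only: An[OF y] G.R_A)
    qed
    show R: "G.R x \<in> range (G.R ^^ Suc n)"
      using G.carrierD[OF G.R_carrier_UNIV[OF x[unfolded Xinf]] UNIV_I] .
    show "A n (G.R x) = x" by (simp only: An[OF R] G.A_R)
  qed
  have lin: "linear_on_carrier smul (G.carrier UNIV) G.A"
    using G.A_add G.A_scale G.carrier_UNIV_D by (simp add: linear_on_carrier_def)
  have hom: "homeomorphic_map (G.level UNIV) (G.level UNIV) G.A"
    using G.homeomorphic_maps_A homeomorphic_map_maps by blast
  have gen: "\<forall>x\<in>G.carrier UNIV. generator smul (G.level UNIV) T x = G.A x"
    using G.generator_level[OF UNIV_not_empty] G.generator_domain_level_UNIV by simp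
  have "\<forall>n. \<tau> n closure_of Xinf = X n"
    by (simp add: \<tau> Xinf X G.dense_level)
  moreover have "\<forall>n. \<forall>x\<in>Xinf. inv_into Xinf (A 0) x = inv_into (generator_domain smul (\<tau> n) T) (A n) x"
    by (simp add: inv_inf inv_n)
  ultimately show ?thesis
    using G.complete_level_UNIV G.semigroup_level G.generator_domain_level_UNIV gen lin hom
    unfolding \<tau>inf A0 by (simp add: Xinf)
qed

end
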